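(* Let $X$ and $Y$ be Banach spaces and let $J$ be a proximinal subspace of $X$ such that the metric projection $P_J$ has a linear selection. Then each of the pairs $(\mathcal{S}(X),\mathcal{S}(J))$, $(\mathcal{F}(X),\mathcal{F}(J))$, $(\mathcal{I}(X),\mathcal{I}(J))$ and $(L(Y,X),L(Y,J))$ has the quotient lifting property (QLP), for each of the choices of spaces $\mathcal{S},\mathcal{F},\mathcal{I}$ listed in the context.
   Context: For a closed subspace $M$ of a Banach space $Z$, with quotient map $\pi:Z\to Z/M$, the pair $(Z,M)$ has the quotient lifting property (QLP) if for every Banach space $V$ and every bounded linear operator $S:V\to Z/M$ there is a bounded linear operator $T:V\to Z$ with $\pi\circ T=S$ and $\|T\|=\|S\|$. The metric projection is $P_M(z)=\{m\in M:\|z-m\|=\mathrm{dist}(z,M)\}$; $M$ is proximinal if $P_M(z)\ne\emptyset$ for all $z\in Z$; a linear selection for $P_M$ is a linear map $q:Z\to M$ with $q(z)\in P_M(z)$ for all $z\in Z$. For a Banach space $X$: $\mathcal{S}(X)$ denotes any one of the $X$-valued sequence spaces $\ell_r(X)$ ($1\le r\le\infty$), $c_0(X)$ (norm-null sequences), $c(X)$ (norm-convergent sequences), the last two with the sup norm. $\mathcal{F}(X)$ denotes either $C(\Omega,X)$ with $\Omega$ compact Hausdorff and the sup norm, or $\mathrm{Lip}(\Omega,X)$, the space of Lipschitz functions from a compact metric space $\Omega$ to $X$, with one of the standard norms $\max\{\|f\|_\infty,L(f)\}$ or $\|f\|_\infty+L(f)$, where $L(f)$ is the Lipschitz constant. $\mathcal{I}(X)$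 denotes either the Lebesgue–Bochner space $L_1(\mu,X)$ or $\hat P_1(\mu,X)$, where $\mu$ is a measure and $\hat P_1(\mu,X)$ is the (completed) space of $\mu$-measurable Pettis integrable functions with norm $\|f\|=\sup\{\int|x^*\circ f|\,d\mu: x^*\in X^*,\|x^*\|\le1\}$. $L(Y,X)$ is the space of bounded linear operators from $Y$ to $X$ with the operator norm. In every case the space built from $J$ is regarded as a (closed) subspace of the one built from $X$. *)

theory Defs
  imports "HOL-Analysis.Analysis"
begin

section \<open>Metric projections\<close>

definition metric_projection :: "'a::real_normed_vector set \<Rightarrow> 'a \<Rightarrow> 'a set" where
  "metric_projection M z = {m \<in> M. norm (z - m) = infdist z M}"

definition proximinal :: "'a::real_normed_vector set \<Rightarrow> bool" where
  "proximinal M \<longleftrightarrow> (\<forall>z. metric_projection M z \<noteq> {})"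

definition linear_selection :: "'a::real_normed_vector set \<Rightarrow> ('a \<Rightarrow> 'a) \<Rightarrow> bool" where
  "linear_selection M q \<longleftrightarrow> linear q \<and> (\<forall>z. q z \<in> metric_projection M z)"


section \<open>Normed spaces with explicit carrier, and the quotient lifting property\<close>

text \<open>
  Spaces such as \<open>\<ell>\<^sub>r(X)\<close> or \<open>L\<^sub>1(\<mu>,X)\<close> depend on values (\<open>r\<close>, \<open>\<mu>\<close>), so they cannot be types of
  class \<^class>\<open>banach\<close>. They are given by a carrier, the vector space operations and a norm.
  Before passing to a quotient the norm may be only a seminorm.
\<close>

record 'a nspace =
  carr :: "'a set"
  add :: "'a \<Rightarrow> 'a \<Rightarrow> 'a"
  scale :: "real \<Rightarrow> 'a \<Rightarrow> 'a"
  nrm :: "'a \<Rightarrow> real"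

definition type_space :: "'a::real_normed_vector nspace" where
  "type_space = \<lparr>carr = UNIV, add = (+), scale = (*\<^sub>R), nrm = norm\<rparr>"

definition function_space ::
    "('i \<Rightarrow> 'a::real_normed_vector) set \<Rightarrow> (('i \<Rightarrow> 'a) \<Rightarrow> real) \<Rightarrow> ('i \<Rightarrow> 'a) nspace" where
  "function_space F p =
    \<lparr>carr = F, add = (\<lambda>f g i. f i + g i), scale = (\<lambda>c f i. c *\<^sub>R f i), nrm = p\<rparr>"

definition coset :: "'a nspace \<Rightarrow> 'a set \<Rightarrow> 'a \<Rightarrow> 'a set" where
  "coset Z M z = add Z z ` M"

text \<open>
  The infimum of the norm over the coset \<open>z + M\<close> is the distance from \<open>z\<close> to \<open>M\<close>.
  Scalar multiplication adds \<open>M\<close> again because \<open>0 \<cdot> (z + M)\<close> has to be \<open>M\<close>, not \<open>{0}\<close>.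
\<close>

definition quotient_space :: "'a nspace \<Rightarrow> 'a set \<Rightarrow> 'a set nspace" where
  "quotient_space Z M =
    \<lparr>carr = coset Z M ` carr Z,
     add = (\<lambda>A B. \<Union>a\<in>A. \<Union>b\<in>B. coset Z M (add Z a b)),
     scale = (\<lambda>c A. \<Union>a\<in>A. coset Z M (scale Z c a)),
     nrm = (\<lambda>A. INF a\<in>A. nrm Z a)\<rparr>"

definition bounded_operator :: "'a nspace \<Rightarrow> ('v::real_normed_vector \<Rightarrow> 'a) \<Rightarrow> bool" where
  "bounded_operator W S \<longleftrightarrow>
    (\<forall>v. S v \<in> carr W) \<and>
    (\<forall>u v. S (u + v) = add W (S u) (S v)) \<and>
    (\<forall>c v. S (c *\<^sub>R v) = scale W c (S v)) \<and>
    (\<exists>K. \<forall>v. nrm W (S v) \<le> K * norm v)"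

text \<open>The analogue of \<^const>\<open>onorm\<close>.\<close>

definition operator_norm :: "'a nspace \<Rightarrow> ('v::real_normed_vector \<Rightarrow> 'a) \<Rightarrow> real" where
  "operator_norm W S = (SUP v. nrm W (S v) / norm v)"

text \<open>
  The Banach space \<open>V\<close> of the lifting property is the type argument; a theorem with a free type
  variable \<open>'v\<close> speaks about all Banach spaces \<open>V\<close>.
\<close>

definition QLP :: "'v::banach itself \<Rightarrow> 'a nspace \<Rightarrow> 'a set \<Rightarrow> bool" where
  "QLP _ Z M \<longleftrightarrow>
    (\<forall>S :: 'v \<Rightarrow> 'a set. bounded_operator (quotient_space Z M) S \<longrightarrow>
      (\<exists>T :: 'v \<Rightarrow> 'a. bounded_operator Z T \<and> (\<forall>v. coset Z M (T v) = S v) \<and>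
        operator_norm Z T = operator_norm (quotient_space Z M) S))"


section \<open>The spaces\<close>

text \<open>
  \<open>E\<close> is a closed subspace of the Banach space \<^typ>\<open>'x\<close>: the space built from \<open>E\<close> is realised inside
  the one built from \<^typ>\<open>'x\<close>, which is the case \<open>E = UNIV\<close>.
\<close>

definition sup_norm :: "('i \<Rightarrow> 'x::real_normed_vector) \<Rightarrow> real" where
  "sup_norm f = (SUP i. norm (f i))"


subsection \<open>Sequence spaces\<close>

definition ell_space :: "real \<Rightarrow> 'x::real_normed_vector set \<Rightarrow> (nat \<Rightarrow> 'x) nspace" where
  "ell_space r E = function_space
    {x. range x \<subseteq> E \<and> summable (\<lambda>n. norm (x n) powr r)}
    (\<lambda>x. (\<Sum>n. norm (x n) powr r) powr (1 / r))"

definition ell_infinity_space :: "'x::real_normed_vector set \<Rightarrow> (nat \<Rightarrow> 'x) nspace" where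
  "ell_infinity_space E = function_space {x. range x \<subseteq> E \<and> bounded (range x)} sup_norm"

definition c0_space :: "'x::real_normed_vector set \<Rightarrow> (nat \<Rightarrow> 'x) nspace" where
  "c0_space E = function_space {x. range x \<subseteq> E \<and> x \<longlonglongrightarrow> 0} sup_norm"

definition c_space :: "'x::real_normed_vector set \<Rightarrow> (nat \<Rightarrow> 'x) nspace" where
  "c_space E = function_space {x. range x \<subseteq> E \<and> (\<exists>l\<in>E. x \<longlonglongrightarrow> l)} sup_norm"


subsection \<open>Lipschitz functions\<close>

definition lipschitz_functions :: "'x::real_normed_vector set \<Rightarrow> ('k::metric_space \<Rightarrow> 'x) set" where
  "lipschitz_functions E = {f. range f \<subseteq> E \<and> (\<exists>L. L-lipschitz_on UNIV f)}"

definition lipschitz_constant :: "('k::metric_space \<Rightarrow> 'x::real_normed_vector) \<Rightarrow> real" where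
  "lipschitz_constant f = Inf {L. L-lipschitz_on UNIV f}"

definition lip_max_space :: "'x::real_normed_vector set \<Rightarrow> ('k::metric_space \<Rightarrow> 'x) nspace" where
  "lip_max_space E = function_space (lipschitz_functions E)
    (\<lambda>f. max (sup_norm f) (lipschitz_constant f))"

definition lip_sum_space :: "'x::real_normed_vector set \<Rightarrow> ('k::metric_space \<Rightarrow> 'x) nspace" where
  "lip_sum_space E = function_space (lipschitz_functions E)
    (\<lambda>f. sup_norm f + lipschitz_constant f)"


subsection \<open>Lebesgue-Bochner and Pettis spaces\<close>

text \<open>
  The library's Bochner integral is developed for separable spaces only, so \<open>\<mu>\<close>-measurability
  (almost everywhere limits of simple functions) is defined here. Such functions are measurable
  only up to a null set, hence the integrals with respect to the completion of \<open>\<mu>\<close>.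
\<close>

definition strongly_measurable ::
    "'m measure \<Rightarrow> 'x::real_normed_vector set \<Rightarrow> ('m \<Rightarrow> 'x) \<Rightarrow> bool" where
  "strongly_measurable \<mu> E f \<longleftrightarrow>
    f ` space \<mu> \<subseteq> E \<and>
    (\<exists>s. (\<forall>i. simple_function \<mu> (s i) \<and> s i ` space \<mu> \<subseteq> E) \<and>
         (AE \<omega> in \<mu>. (\<lambda>i::nat. s i \<omega>) \<longlonglongrightarrow> f \<omega>))"

definition null_vectors :: "'a nspace \<Rightarrow> 'a set" where
  "null_vectors Z = {z \<in> carr Z. nrm Z z = 0}"

definition bochner_functions :: "'m measure \<Rightarrow> 'x::real_normed_vector set \<Rightarrow> ('m \<Rightarrow> 'x) set" where
  "bochner_functions \<mu> E =
    {f. strongly_measurable \<mu> E f \<and> integrable (completion \<mu>) (\<lambda>\<omega>. norm (f \<omega>))}"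

definition bochner_seminormed :: "'m measure \<Rightarrow> ('m \<Rightarrow> 'x::real_normed_vector) nspace" where
  "bochner_seminormed \<mu> = function_space (bochner_functions \<mu> UNIV)
    (\<lambda>f. \<integral>\<omega>. norm (f \<omega>) \<partial>completion \<mu>)"

text \<open>The null vectors are the functions that vanish almost everywhere.\<close>

definition L1_space :: "'m measure \<Rightarrow> ('m \<Rightarrow> 'x::real_normed_vector) set nspace" where
  "L1_space \<mu> = quotient_space (bochner_seminormed \<mu>) (null_vectors (bochner_seminormed \<mu>))"

definition L1_subspace ::
    "'m measure \<Rightarrow> 'x::real_normed_vector set \<Rightarrow> ('m \<Rightarrow> 'x) set set" where
  "L1_subspace \<mu> E =
    coset (bochner_seminormed \<mu>) (null_vectors (bochner_seminormed \<mu>)) ` bochner_functions \<mu> E"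

text \<open>
  Bounded linear functionals on the subspace \<open>E\<close>; values outside \<open>E\<close> are irrelevant.
\<close>

definition functional_on :: "'x::real_normed_vector set \<Rightarrow> ('x \<Rightarrow> real) \<Rightarrow> bool" where
  "functional_on E \<phi> \<longleftrightarrow>
    (\<forall>x\<in>E. \<forall>y\<in>E. \<phi> (x + y) = \<phi> x + \<phi> y) \<and>
    (\<forall>c. \<forall>x\<in>E. \<phi> (c *\<^sub>R x) = c * \<phi> x) \<and>
    (\<exists>K. \<forall>x\<in>E. \<bar>\<phi> x\<bar> \<le> K * norm x)"

definition pettis_functions :: "'m measure \<Rightarrow> 'x::real_normed_vector set \<Rightarrow> ('m \<Rightarrow> 'x) set" where
  "pettis_functions \<mu> E =
    {f. strongly_measurable \<mu> E f \<and>
        (\<forall>\<phi>. functional_on E \<phi> \<longrightarrow> integrable (completion \<mu>) (\<lambda>\<omega>. \<phi> (f \<omega>))) \<and>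
        (\<forall>A\<in>sets \<mu>. \<exists>v\<in>E. \<forall>\<phi>. functional_on E \<phi> \<longrightarrow>
          \<phi> v = (LINT \<omega>:A|completion \<mu>. \<phi> (f \<omega>)))}"

definition pettis_norm :: "'m measure \<Rightarrow> ('m \<Rightarrow> 'x::real_normed_vector) \<Rightarrow> real" where
  "pettis_norm \<mu> f =
    (SUP \<phi>\<in>{\<phi> :: 'x \<Rightarrow>\<^sub>L real. norm \<phi> \<le> 1}. \<integral>\<omega>. \<bar>blinfun_apply \<phi> (f \<omega>)\<bar> \<partial>completion \<mu>)"

definition pettis_seminormed :: "'m measure \<Rightarrow> ('m \<Rightarrow> 'x::real_normed_vector) nspace" where
  "pettis_seminormed \<mu> = function_space (pettis_functions \<mu> UNIV) (pettis_norm \<mu>)"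

text \<open>The completion of a seminormed space: Cauchy sequences modulo null sequences.\<close>

definition cauchy_sequences :: "'a nspace \<Rightarrow> 'a set \<Rightarrow> (nat \<Rightarrow> 'a) set" where
  "cauchy_sequences Z F =
    {s. range s \<subseteq> F \<and>
        (\<forall>e>0. \<exists>N. \<forall>m\<ge>N. \<forall>n\<ge>N. nrm Z (add Z (s m) (scale Z (-1) (s n))) < e)}"

definition cauchy_space :: "'a nspace \<Rightarrow> (nat \<Rightarrow> 'a) nspace" where
  "cauchy_space Z =
    \<lparr>carr = cauchy_sequences Z (carr Z),
     add = (\<lambda>s t n. add Z (s n) (t n)),
     scale = (\<lambda>c s n. scale Z c (s n)),
     nrm = (\<lambda>s. lim (\<lambda>n. nrm Z (s n)))\<rparr>"

definition completed_space :: "'a nspace \<Rightarrow> (nat \<Rightarrow> 'a) set nspace" where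
  "completed_space Z = quotient_space (cauchy_space Z) (null_vectors (cauchy_space Z))"

definition completed_subspace :: "'a nspace \<Rightarrow> 'a set \<Rightarrow> (nat \<Rightarrow> 'a) set set" where
  "completed_subspace Z F =
    coset (cauchy_space Z) (null_vectors (cauchy_space Z)) ` cauchy_sequences Z F"

text \<open>
  By the Hahn-Banach theorem the Pettis norms formed with functionals on \<open>E\<close> and on the whole space
  agree for \<open>E\<close>-valued functions, so \<open>completed_subspace\<close> is the completion of the space
  of \<open>E\<close>-valued functions.
\<close>

definition P1_space :: "'m measure \<Rightarrow> (nat \<Rightarrow> 'm \<Rightarrow> 'x::real_normed_vector) set nspace" where
  "P1_space \<mu> = completed_space (pettis_seminormed \<mu>)"

definition P1_subspace ::
    "'m measure \<Rightarrow> 'x::real_normed_vector set \<Rightarrow> (nat \<Rightarrow> 'm \<Rightarrow> 'x) set set" where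
  "P1_subspace \<mu> E = completed_subspace (pettis_seminormed \<mu>) (pettis_functions \<mu> E)"

end

theory Submission
  imports Defs
begin

text \<open>
  Let \<open>q\<close> be a linear selection for the metric projection onto \<open>J\<close> and put \<open>p x = x - q x\<close>.
  Then \<open>norm (p x)\<close> is the distance from \<open>x\<close> to \<open>J\<close>, so \<open>p\<close> is a linear contraction,
  it vanishes exactly on \<open>J\<close>, and \<open>p x\<close> differs from \<open>x\<close> by an element of \<open>J\<close>. In other
  words, \<open>p\<close> factors through \<open>X/J\<close> as a linear isometric right inverse of the quotient map.

  This structure passes to every space in the theorem. Applying \<open>p\<close> to the values of a sequence, of a
  function or of an operator gives a linear contraction \<open>P\<close> of the large space \<open>Z\<close> that vanishes on the
  subspace \<open>M\<close> of \<open>J\<close>-valued elements, and \<open>P z\<close> differs from \<open>z\<close> by an element of \<open>M\<close>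
  because \<open>q\<close> is bounded and maps into \<open>J\<close>. The locale \<open>contractive_lifting\<close> captures this
  situation. In it \<open>P z\<close> is an element of least norm in \<open>z + M\<close> and depends only on that coset, so
  for an operator \<open>S\<close> into \<open>Z/M\<close> the vectors \<open>P z\<close> with \<open>z + M = S v\<close> define a linear
  lifting \<open>T\<close> with \<open>norm (T v) = norm (S v)\<close> for every \<open>v\<close>; this is
  \<open>contractive_lifting.QLP\<close>.

  The elements of \<open>L\<^sub>1\<close> and \<open>P\<^sub>1\<close> are not functions but classes of functions or of Cauchy
  sequences of functions. The lemmas \<open>quotient_lifting\<close> and \<open>cauchy_lifting\<close> carry a contractive
  lifting along the formation of such classes, so that only the underlying seminormed function spaces have
  to be treated. The main analytic fact involved is that the Pettis norm of a Pettis integrable function is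
  finite (\<open>pettis_norm_bdd_above\<close>), a consequence of Baire's theorem in the dual space and Fatou's lemma.
\<close>


section \<open>Quotients of spaces with explicit carrier\<close>

locale carrier_vector_space =
  fixes Z :: "'a nspace" and \<theta> :: 'a
  assumes zero_closed: "\<theta> \<in> carr Z"
    and add_closed: "x \<in> carr Z \<Longrightarrow> y \<in> carr Z \<Longrightarrow> add Z x y \<in> carr Z"
    and scale_closed: "x \<in> carr Z \<Longrightarrow> scale Z c x \<in> carr Z"
    and zero_add: "x \<in> carr Z \<Longrightarrow> add Z \<theta> x = x"
    and add_assoc: "x \<in> carr Z \<Longrightarrow> y \<in> carr Z \<Longrightarrow> z \<in> carr Z \<Longrightarrow>
      add Z (add Z x y) z = add Z x (add Z y z)"
    and add_commute: "x \<in> carr Z \<Longrightarrow> y \<in> carr Z \<Longrightarrow> add Z x y = add Z y x"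
    and scale_add: "x \<in> carr Z \<Longrightarrow> y \<in> carr Z \<Longrightarrow>
      scale Z c (add Z x y) = add Z (scale Z c x) (scale Z c y)"
    and add_scale: "x \<in> carr Z \<Longrightarrow> scale Z (a + b) x = add Z (scale Z a x) (scale Z b x)"
    and scale_scale: "x \<in> carr Z \<Longrightarrow> scale Z a (scale Z b x) = scale Z (a * b) x"
    and scale_one: "x \<in> carr Z \<Longrightarrow> scale Z 1 x = x"
    and zero_scale: "x \<in> carr Z \<Longrightarrow> scale Z 0 x = \<theta>"
begin

lemma add_zero: "x \<in> carr Z \<Longrightarrow> add Z x \<theta> = x"
  using zero_add add_commute zero_closed by metis

lemma scale_zero: "scale Z c \<theta> = \<theta>"
  using zero_scale[OF zero_closed] scale_scale[OF zero_closed, of c 0] by simp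

lemma add_minus: "x \<in> carr Z \<Longrightarrow> add Z x (scale Z (-1) x) = \<theta>"
  using add_scale[of x 1 "-1"] by (simp add: scale_one zero_scale)

lemma add_add_swap:
  assumes "a \<in> carr Z" "b \<in> carr Z" "c \<in> carr Z" "d \<in> carr Z"
  shows "add Z (add Z a b) (add Z c d) = add Z (add Z a c) (add Z b d)"
proof -
  have "add Z (add Z a b) (add Z c d) = add Z a (add Z (add Z b c) d)"
    using assms by (simp add: add_assoc add_closed)
  also have "add Z b c = add Z c b" using assms by (simp add: add_commute)
  finally show ?thesis using assms by (simp add: add_assoc add_closed)
qed

lemma add_minus_add:
  assumes "x \<in> carr Z" "y \<in> carr Z"
  shows "add Z (add Z x (scale Z (-1) y)) y = x"
  using assms
  by (simp add: add_assoc scale_closed add_commute[of "scale Z (-1) y" y] add_minus add_zero)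

lemma add_add_minus:
  assumes "x \<in> carr Z" "y \<in> carr Z"
  shows "add Z (add Z x y) (scale Z (-1) y) = x"
  using assms by (simp add: add_assoc scale_closed add_minus add_zero)

end

locale carrier_subspace = carrier_vector_space +
  fixes M :: "'a set"
  assumes subset_carrier: "M \<subseteq> carr Z"
    and zero_mem: "\<theta> \<in> M"
    and add_mem: "m \<in> M \<Longrightarrow> n \<in> M \<Longrightarrow> add Z m n \<in> M"
    and scale_mem: "m \<in> M \<Longrightarrow> scale Z c m \<in> M"
begin

lemma mem_carrier: "m \<in> M \<Longrightarrow> m \<in> carr Z"
  using subset_carrier by blast

lemma coset_self: "x \<in> carr Z \<Longrightarrow> x \<in> coset Z M x"
  using add_zero zero_mem by (force simp: coset_def)

lemma coset_subset: "x \<in> carr Z \<Longrightarrow> coset Z M x \<subseteq> carr Z"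
  by (auto simp: coset_def add_closed mem_carrier)

lemma coset_add_mem:
  assumes x: "x \<in> carr Z" and m: "m \<in> M"
  shows "coset Z M (add Z x m) = coset Z M x"
proof -
  have 1: "coset Z M (add Z y n) \<subseteq> coset Z M y" if "y \<in> carr Z" "n \<in> M" for y n
    using that by (auto simp: coset_def add_assoc mem_carrier add_mem)
  have "coset Z M (add Z (add Z x m) (scale Z (-1) m)) \<subseteq> coset Z M (add Z x m)"
    using x m by (intro 1) (auto simp: scale_mem add_closed mem_carrier)
  then show ?thesis
    using 1[OF x m] x m by (simp add: add_add_minus mem_carrier)
qed

lemma coset_zero: "coset Z M \<theta> = M"
  by (force simp: coset_def zero_add mem_carrier)

lemma coset_eqD:
  assumes "coset Z M x = coset Z M y" "y \<in> carr Z"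
  shows "\<exists>m\<in>M. y = add Z x m"
  using assms coset_self[of y] by (auto simp: coset_def)

lemma coset_UN:
  assumes "x \<in> carr Z" and "\<And>m. m \<in> M \<Longrightarrow> g (add Z x m) = c"
  shows "(\<Union>a\<in>coset Z M x. g a) = c"
  using assms zero_mem by (auto simp: coset_def)

lemma quotient_add:
  assumes "x \<in> carr Z" "y \<in> carr Z"
  shows "add (quotient_space Z M) (coset Z M x) (coset Z M y) = coset Z M (add Z x y)"
proof -
  have "coset Z M (add Z (add Z x m) (add Z y n)) = coset Z M (add Z x y)"
    if "m \<in> M" "n \<in> M" for m n
    using assms that
    by (simp add: add_add_swap[of x m y n] mem_carrier coset_add_mem add_closed add_mem)
  then show ?thesis
    using assms by (simp add: quotient_space_def coset_UN)
qed

lemma quotient_scale: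
  assumes "x \<in> carr Z"
  shows "scale (quotient_space Z M) c (coset Z M x) = coset Z M (scale Z c x)"
  using assms
  by (simp add: quotient_space_def coset_UN scale_add mem_carrier coset_add_mem scale_closed
      scale_mem)

lemma quotient_carrier: "carr (quotient_space Z M) = coset Z M ` carr Z"
  by (simp add: quotient_space_def)

lemma quotient_norm: "nrm (quotient_space Z M) A = (INF a\<in>A. nrm Z a)"
  by (simp add: quotient_space_def)

lemma quotient_vector_space: "carrier_vector_space (quotient_space Z M) M"
proof
  show "M \<in> carr (quotient_space Z M)"
    using zero_closed coset_zero by (auto simp: quotient_carrier)
  show "add (quotient_space Z M) M A = A" if "A \<in> carr (quotient_space Z M)" for A
  proof -
    from that obtain x where x: "x \<in> carr Z" "A = coset Z M x" by (auto simp: quotient_carrier)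
    then show ?thesis
      using quotient_add[OF zero_closed x(1)] by (simp add: coset_zero zero_add)
  qed
  show "scale (quotient_space Z M) 0 A = M" if "A \<in> carr (quotient_space Z M)" for A
    using that by (auto simp: quotient_carrier quotient_scale zero_scale coset_zero)
  show "add (quotient_space Z M) A B = add (quotient_space Z M) B A"
    if "A \<in> carr (quotient_space Z M)" "B \<in> carr (quotient_space Z M)" for A B
    using that by (auto simp: quotient_carrier quotient_add add_commute)
qed (auto simp: quotient_carrier quotient_add quotient_scale add_closed scale_closed add_assoc
    scale_add add_scale scale_scale scale_one)

end


section \<open>Contractive liftings\<close>

text \<open>
  The data from which every lifting is obtained: an algebraic projection \<open>P\<close> along \<open>M\<close> that does
  not increase the norm. It factors through \<open>Z/M\<close> and picks from each coset an element of
  least norm, so \<open>P \<circ> S\<close>, computed on representatives, is a lifting of \<open>S\<close>.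
\<close>

locale contractive_lifting = carrier_subspace +
  fixes P :: "'a \<Rightarrow> 'a"
  assumes P_add: "x \<in> carr Z \<Longrightarrow> y \<in> carr Z \<Longrightarrow> P (add Z x y) = add Z (P x) (P y)"
    and P_scale: "x \<in> carr Z \<Longrightarrow> P (scale Z c x) = scale Z c (P x)"
    and P_mem: "m \<in> M \<Longrightarrow> P m = \<theta>"
    and P_coset: "x \<in> carr Z \<Longrightarrow> \<exists>m\<in>M. P x = add Z x m"
    and P_contractive: "x \<in> carr Z \<Longrightarrow> nrm Z (P x) \<le> nrm Z x"
begin

lemma P_closed: "x \<in> carr Z \<Longrightarrow> P x \<in> carr Z"
  using P_coset[of x] add_closed mem_carrier by metis

lemma P_add_mem: "x \<in> carr Z \<Longrightarrow> m \<in> M \<Longrightarrow> P (add Z x m) = P x"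
  by (simp add: P_add mem_carrier P_mem P_closed add_zero)

lemma coset_P: "x \<in> carr Z \<Longrightarrow> coset Z M (P x) = coset Z M x"
  using P_coset[of x] coset_add_mem by metis

text \<open>
  \<open>P\<close> takes the same value \<open>P x\<close> on the whole coset, so by contractivity the
  norm of \<open>P x\<close> is at most that of any element; and \<open>P x\<close> itself lies in the coset. The
  infimum is a minimum.
\<close>

lemma nrm_P_eq_quotient_norm:
  assumes x: "x \<in> carr Z"
  shows "nrm Z (P x) = nrm (quotient_space Z M) (coset Z M x)"
proof -
  have "Inf (nrm Z ` coset Z M x) = nrm Z (P x)"
  proof (rule cInf_eq_minimum)
    show "nrm Z (P x) \<in> nrm Z ` coset Z M x"
      using P_coset[OF x] by (auto simp: coset_def)
  next
    fix t assume "t \<in> nrm Z ` coset Z M x"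
    then obtain m where m: "m \<in> M" "t = nrm Z (add Z x m)" by (auto simp: coset_def)
    then show "nrm Z (P x) \<le> t"
      using P_contractive[of "add Z x m"] x by (simp add: P_add_mem add_closed mem_carrier)
  qed
  then show ?thesis by (simp add: quotient_norm)
qed

text \<open>
  The lifting preserves the norm of each single vector, not just the operator norm. The two operator
  norms are therefore suprema of one and the same function.
\<close>

theorem QLP: "QLP TYPE('v::banach) Z M"
  unfolding QLP_def
proof (intro allI impI)
  fix S :: "'v \<Rightarrow> 'a set"
  assume "bounded_operator (quotient_space Z M) S"
  then have S_closed: "\<And>v. S v \<in> coset Z M ` carr Z"
    and S_add: "\<And>u v. S (u + v) = add (quotient_space Z M) (S u) (S v)"
    and S_scale: "\<And>c v. S (c *\<^sub>R v) = scale (quotient_space Z M) c (S v)"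
    and S_bounded: "\<exists>K. \<forall>v. nrm (quotient_space Z M) (S v) \<le> K * norm v"
    by (auto simp: bounded_operator_def quotient_carrier)
  have "\<forall>v. \<exists>x. x \<in> carr Z \<and> S v = coset Z M x"
    using S_closed by (auto simp: image_iff)
  then obtain s where s: "\<And>v. s v \<in> carr Z" "\<And>v. S v = coset Z M (s v)"
    unfolding choice_iff by blast
  define T where "T v = P (s v)" for v
  have T_eq: "T v = P x" if "x \<in> carr Z" "S v = coset Z M x" for v x
  proof -
    have "coset Z M (s v) = coset Z M x" using that(2) s(2) by simp
    from coset_eqD[OF this that(1)] obtain m where "m \<in> M" "x = add Z (s v) m" ..
    then show ?thesis by (simp add: T_def P_add_mem s(1))
  qed
  have T_closed: "T v \<in> carr Z" for v
    by (simp add: T_def P_closed s(1))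
  have T_add: "T (u + v) = add Z (T u) (T v)" for u v
  proof -
    have "T (u + v) = P (add Z (s u) (s v))"
      using S_add[of u v] s by (intro T_eq) (simp_all add: add_closed quotient_add)
    then show ?thesis by (simp add: T_def P_add s(1))
  qed
  have T_scale: "T (c *\<^sub>R v) = scale Z c (T v)" for c v
  proof -
    have "T (c *\<^sub>R v) = P (scale Z c (s v))"
      using S_scale[of c v] s by (intro T_eq) (simp_all add: scale_closed quotient_scale)
    then show ?thesis by (simp add: T_def P_scale s(1))
  qed
  have T_norm: "nrm Z (T v) = nrm (quotient_space Z M) (S v)" for v
    by (simp add: T_def nrm_P_eq_quotient_norm s)
  have "bounded_operator Z T"
    using S_bounded by (simp add: bounded_operator_def T_closed T_add T_scale T_norm)
  moreover have "coset Z M (T v) = S v" for v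
    by (simp add: T_def coset_P s)
  moreover have "operator_norm Z T = operator_norm (quotient_space Z M) S"
    by (simp add: operator_norm_def T_norm)
  ultimately show "\<exists>T. bounded_operator Z T \<and> (\<forall>v. coset Z M (T v) = S v) \<and>
      operator_norm Z T = operator_norm (quotient_space Z M) S"
    by blast
qed

end


section \<open>Passing to null classes and to completions\<close>

locale carrier_seminormed_space = carrier_vector_space +
  assumes triangle: "x \<in> carr Z \<Longrightarrow> y \<in> carr Z \<Longrightarrow> nrm Z (add Z x y) \<le> nrm Z x + nrm Z y"
    and homogeneous: "x \<in> carr Z \<Longrightarrow> nrm Z (scale Z c x) \<le> \<bar>c\<bar> * nrm Z x"
begin

lemma nrm_minus_le: "x \<in> carr Z \<Longrightarrow> nrm Z (scale Z (-1) x) \<le> nrm Z x"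
  using homogeneous[of x "-1"] by simp

lemma nrm_zero: "nrm Z \<theta> = 0"
  using homogeneous[OF zero_closed, of 0] triangle[OF zero_closed zero_closed]
  by (simp add: scale_zero zero_add zero_closed)

lemma nrm_nonneg: "x \<in> carr Z \<Longrightarrow> 0 \<le> nrm Z x"
  using triangle[of x "scale Z (-1) x"] nrm_minus_le[of x]
  by (simp add: add_minus nrm_zero scale_closed)

lemma null_subspace: "carrier_subspace Z \<theta> (null_vectors Z)"
proof
  fix m n c
  assume m: "m \<in> null_vectors Z"
  show "scale Z c m \<in> null_vectors Z"
    using m homogeneous[of m c] nrm_nonneg[of "scale Z c m"]
    by (simp add: null_vectors_def scale_closed)
  assume n: "n \<in> null_vectors Z"
  show "add Z m n \<in> null_vectors Z"
    using m n triangle[of m n] nrm_nonneg[of "add Z m n"]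
    by (simp add: null_vectors_def add_closed)
qed (auto simp: null_vectors_def zero_closed nrm_zero)

lemma nrm_abs_diff_le:
  assumes "x \<in> carr Z" "y \<in> carr Z"
  shows "\<bar>nrm Z x - nrm Z y\<bar> \<le> nrm Z (add Z x (scale Z (-1) y))"
proof -
  have 1: "nrm Z v \<le> nrm Z (add Z v (scale Z (-1) w)) + nrm Z w"
    if "v \<in> carr Z" "w \<in> carr Z" for v w
    using triangle[of "add Z v (scale Z (-1) w)" w] that
    by (simp add: add_minus_add add_closed scale_closed)
  have "add Z y (scale Z (-1) x) = scale Z (-1) (add Z x (scale Z (-1) y))"
    by (simp add: scale_add scale_closed scale_scale scale_one assms add_commute)
  then have 2: "nrm Z (add Z y (scale Z (-1) x)) \<le> nrm Z (add Z x (scale Z (-1) y))"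
    by (simp add: nrm_minus_le assms add_closed scale_closed)
  show ?thesis using 1[OF assms] 1[OF assms(2,1)] 2 by linarith
qed

end

text \<open>
  The spaces \<open>L\<^sub>1\<close> and \<open>P\<^sub>1\<close> arise from seminormed function spaces by dividing out
  null vectors and by completing. A contractive lifting survives both constructions, because a
  contraction preserves null vectors and Cauchy sequences; here the seminorm axioms are essential, as
  null vectors and Cauchy sequences have to form vector spaces.
\<close>

locale seminormed_contractive_lifting = contractive_lifting + carrier_seminormed_space
begin

lemma quotient_lifting:
  defines "N \<equiv> null_vectors Z"
  shows "contractive_lifting (quotient_space Z N) N (coset Z N ` M) (\<lambda>A. \<Union>a\<in>A. coset Z N (P a))"
proof -
  interpret N: carrier_subspace Z \<theta> N
    unfolding N_def by (rule null_subspace)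
  interpret Q: carrier_vector_space "quotient_space Z N" N
    by (rule N.quotient_vector_space)
  have P_null: "P n \<in> N" if "n \<in> N" for n
  proof -
    have "n \<in> carr Z" "nrm Z n = 0" using that by (auto simp: N_def null_vectors_def)
    then show ?thesis
      using P_contractive[of n] nrm_nonneg[of "P n"] P_closed[of n]
      by (simp add: N_def null_vectors_def)
  qed
  have lift: "(\<Union>a\<in>coset Z N x. coset Z N (P a)) = coset Z N (P x)" if "x \<in> carr Z" for x
    using that
    by (intro N.coset_UN) (simp_all add: P_add N.mem_carrier N.coset_add_mem P_closed P_null)
  show ?thesis
  proof
    show "coset Z N ` M \<subseteq> carr (quotient_space Z N)"
      using subset_carrier by (auto simp: N.quotient_carrier)
    show "N \<in> coset Z N ` M"
      using zero_mem N.coset_zero by auto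
    show "add (quotient_space Z N) A B \<in> coset Z N ` M"
      if "A \<in> coset Z N ` M" "B \<in> coset Z N ` M" for A B
      using that by (auto simp: N.quotient_add mem_carrier add_mem)
    show "scale (quotient_space Z N) c A \<in> coset Z N ` M" if "A \<in> coset Z N ` M" for c A
      using that by (auto simp: N.quotient_scale mem_carrier scale_mem)
    show "(\<Union>a\<in>add (quotient_space Z N) A B. coset Z N (P a)) =
        add (quotient_space Z N) (\<Union>a\<in>A. coset Z N (P a)) (\<Union>a\<in>B. coset Z N (P a))"
      if "A \<in> carr (quotient_space Z N)" "B \<in> carr (quotient_space Z N)" for A B
    proof -
      from that obtain x y where "x \<in> carr Z" "y \<in> carr Z" "A = coset Z N x" "B = coset Z N y"
        by (auto simp: N.quotient_carrier)
      then show ?thesis by (simp add: N.quotient_add lift add_closed P_add P_closed)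
    qed
    show "(\<Union>a\<in>scale (quotient_space Z N) c A. coset Z N (P a)) =
        scale (quotient_space Z N) c (\<Union>a\<in>A. coset Z N (P a))"
      if "A \<in> carr (quotient_space Z N)" for c A
    proof -
      from that obtain x where "x \<in> carr Z" "A = coset Z N x"
        by (auto simp: N.quotient_carrier)
      then show ?thesis by (simp add: N.quotient_scale lift scale_closed P_scale P_closed)
    qed
    show "(\<Union>a\<in>A. coset Z N (P a)) = N" if "A \<in> coset Z N ` M" for A
    proof -
      from that obtain m where "m \<in> M" "A = coset Z N m" by blast
      then show ?thesis by (simp add: lift mem_carrier P_mem N.coset_zero)
    qed
    show "\<exists>B\<in>coset Z N ` M. (\<Union>a\<in>A. coset Z N (P a)) = add (quotient_space Z N) A B"
      if "A \<in> carr (quotient_space Z N)" for A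
    proof -
      from that obtain x where x: "x \<in> carr Z" "A = coset Z N x"
        by (auto simp: N.quotient_carrier)
      obtain m where "m \<in> M" "P x = add Z x m"
        using P_coset[OF x(1)] by blast
      then show ?thesis
        using x by (intro bexI[of _ "coset Z N m"]) (auto simp: lift N.quotient_add mem_carrier)
    qed
    show "nrm (quotient_space Z N) (\<Union>a\<in>A. coset Z N (P a)) \<le> nrm (quotient_space Z N) A"
      if "A \<in> carr (quotient_space Z N)" for A
    proof -
      from that obtain x where x: "x \<in> carr Z" "A = coset Z N x"
        by (auto simp: N.quotient_carrier)
      have "(INF a\<in>coset Z N (P x). nrm Z a) \<le> nrm Z a" if a: "a \<in> coset Z N x" for a
      proof -
        obtain n where n: "n \<in> N" "a = add Z x n"
          using a by (auto simp: coset_def)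
        have a': "a \<in> carr Z" using n x by (simp add: add_closed N.mem_carrier)
        have "P a = add Z (P x) (P n)" using n x by (simp add: P_add N.mem_carrier)
        then have "P a \<in> coset Z N (P x)" using P_null[OF n(1)] by (simp add: coset_def)
        moreover have "bdd_below (nrm Z ` coset Z N (P x))"
          using N.coset_subset[OF P_closed[OF x(1)]] nrm_nonneg by (intro bdd_belowI2[of _ 0]) blast
        ultimately have "(INF a\<in>coset Z N (P x). nrm Z a) \<le> nrm Z (P a)"
          by (intro cINF_lower)
        also have "\<dots> \<le> nrm Z a" by (rule P_contractive[OF a'])
        finally show ?thesis .
      qed
      moreover have "coset Z N x \<noteq> {}" using N.coset_self[OF x(1)] by blast
      ultimately have "(INF a\<in>coset Z N (P x). nrm Z a) \<le> (INF a\<in>coset Z N x. nrm Z a)"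
        by (intro cINF_greatest)
      then show ?thesis using x by (simp add: N.quotient_norm lift)
    qed
  qed
qed

lemma cauchy_lifting:
  "seminormed_contractive_lifting (cauchy_space Z) (\<lambda>_. \<theta>) (cauchy_sequences Z M) (\<lambda>s n. P (s n))"
proof -
  let ?d = "\<lambda>x y. nrm Z (add Z x (scale Z (-1) y))"
  have cauchyD: "\<exists>N. \<forall>m\<ge>N. \<forall>n\<ge>N. ?d (s m) (s n) < e"
    if "s \<in> cauchy_sequences Z F" "e > 0" for s F e
    using that by (simp add: cauchy_sequences_def)
  \<comment> \<open>Every sequence below is Cauchy because its differences are dominated by those of two sequences
    already known to be Cauchy.\<close>
  have cauchyI: "u \<in> cauchy_sequences Z F"
    if F: "range u \<subseteq> F" and s: "s \<in> cauchy_sequences Z (carr Z)"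
      and t: "t \<in> cauchy_sequences Z (carr Z)"
      and K: "\<And>m n. ?d (u m) (u n) \<le> K * ?d (s m) (s n) + ?d (t m) (t n)"
    for F s t u and K :: real
    unfolding cauchy_sequences_def
  proof (intro CollectI conjI F allI impI)
    fix e :: real assume e: "e > 0"
    define L where "L = \<bar>K\<bar> + 1"
    have L: "L > 0" by (simp add: L_def)
    have "\<exists>N. \<forall>m\<ge>N. \<forall>n\<ge>N. ?d (s m) (s n) < e / 2 / L"
      by (rule cauchyD[OF s divide_pos_pos[OF half_gt_zero[OF e] L]])
    then obtain N1 where N1: "\<And>m n. m \<ge> N1 \<Longrightarrow> n \<ge> N1 \<Longrightarrow> ?d (s m) (s n) < e / 2 / L"
      by blast
    have "\<exists>N. \<forall>m\<ge>N. \<forall>n\<ge>N. ?d (t m) (t n) < e / 2"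
      by (rule cauchyD[OF t half_gt_zero[OF e]])
    then obtain N2 where N2: "\<And>m n. m \<ge> N2 \<Longrightarrow> n \<ge> N2 \<Longrightarrow> ?d (t m) (t n) < e / 2"
      by blast
    have "?d (u m) (u n) < e" if "m \<ge> max N1 N2" "n \<ge> max N1 N2" for m n
    proof -
      have "s m \<in> carr Z" "s n \<in> carr Z" using s by (auto simp: cauchy_sequences_def)
      then have nn: "0 \<le> ?d (s m) (s n)" by (intro nrm_nonneg add_closed scale_closed)
      have "K * ?d (s m) (s n) \<le> L * ?d (s m) (s n)"
        using nn by (intro mult_right_mono) (auto simp: L_def)
      also have "\<dots> \<le> e / 2" using N1[of m n] that L by (simp add: field_simps)
      finally show ?thesis using K[of m n] N2[of m n] that by simp
    qed
    then show "\<exists>N. \<forall>m\<ge>N. \<forall>n\<ge>N. ?d (u m) (u n) < e" by blast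
  qed
  have const: "(\<lambda>_. \<theta>) \<in> cauchy_sequences Z F" if "\<theta> \<in> F" for F
    using that by (auto simp: cauchy_sequences_def scale_zero zero_add zero_closed nrm_zero)
  have mono: "cauchy_sequences Z M \<subseteq> cauchy_sequences Z (carr Z)"
    using subset_carrier by (auto simp: cauchy_sequences_def)
  have elem: "s n \<in> F" if "s \<in> cauchy_sequences Z F" for s n F
    using that by (auto simp: cauchy_sequences_def)
  have elemC: "s n \<in> carr Z" if "s \<in> cauchy_sequences Z (carr Z)" for s n
    using that by (rule elem)
  have add_c: "(\<lambda>n. add Z (s n) (t n)) \<in> cauchy_sequences Z F"
    if s: "s \<in> cauchy_sequences Z F" and t: "t \<in> cauchy_sequences Z F"
      and F: "F \<subseteq> carr Z" "\<And>x y. x \<in> F \<Longrightarrow> y \<in> F \<Longrightarrow> add Z x y \<in> F" for s t F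
  proof -
    have C: "s \<in> cauchy_sequences Z (carr Z)" "t \<in> cauchy_sequences Z (carr Z)"
      using s t F(1) by (auto simp: cauchy_sequences_def)
    show ?thesis
    proof (rule cauchyI[OF _ C, of _ _ 1])
      show "range (\<lambda>n. add Z (s n) (t n)) \<subseteq> F"
        using F(2) elem[OF s] elem[OF t] by auto
      fix m n
      have "add Z (add Z (s m) (t m)) (scale Z (-1) (add Z (s n) (t n))) =
          add Z (add Z (s m) (scale Z (-1) (s n))) (add Z (t m) (scale Z (-1) (t n)))"
        by (simp add: scale_add elemC[OF C(1)] elemC[OF C(2)] scale_closed add_add_swap)
      then show "?d (add Z (s m) (t m)) (add Z (s n) (t n))
          \<le> 1 * ?d (s m) (s n) + ?d (t m) (t n)"
        using triangle[of "add Z (s m) (scale Z (-1) (s n))" "add Z (t m) (scale Z (-1) (t n))"]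
        by (simp add: elemC[OF C(1)] elemC[OF C(2)] scale_closed add_closed)
    qed
  qed
  have scale_c: "(\<lambda>n. scale Z c (s n)) \<in> cauchy_sequences Z F"
    if s: "s \<in> cauchy_sequences Z F"
      and F: "F \<subseteq> carr Z" "\<And>x. x \<in> F \<Longrightarrow> scale Z c x \<in> F" for s c F
  proof -
    have C: "s \<in> cauchy_sequences Z (carr Z)"
      using s F(1) by (auto simp: cauchy_sequences_def)
    show ?thesis
    proof (rule cauchyI[OF _ C const[OF zero_closed], of _ _ "\<bar>c\<bar>"])
      show "range (\<lambda>n. scale Z c (s n)) \<subseteq> F"
        using F(2) elem[OF s] by auto
      fix m n
      have "add Z (scale Z c (s m)) (scale Z (-1) (scale Z c (s n))) =
          scale Z c (add Z (s m) (scale Z (-1) (s n)))"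
        by (simp add: scale_add elemC[OF C] scale_closed scale_scale)
      then show "?d (scale Z c (s m)) (scale Z c (s n)) \<le> \<bar>c\<bar> * ?d (s m) (s n) + ?d \<theta> \<theta>"
        using homogeneous[of "add Z (s m) (scale Z (-1) (s n))" c]
        by (simp add: elemC[OF C] scale_closed add_closed scale_zero zero_add zero_closed nrm_zero)
    qed
  qed
  \<comment> \<open>The correction terms \<open>P (s n) - s n\<close> lie in \<open>M\<close>; contractivity makes them Cauchy.\<close>
  have diff_P: "\<exists>u \<in> cauchy_sequences Z M. (\<lambda>n. P (s n)) = (\<lambda>n. add Z (s n) (u n))"
    if s: "s \<in> cauchy_sequences Z (carr Z)" for s
  proof -
    obtain u where u: "\<And>n. u n \<in> M" "\<And>n. P (s n) = add Z (s n) (u n)"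
      using P_coset[OF elemC[OF s]] by metis
    have u_eq: "u n = add Z (P (s n)) (scale Z (-1) (s n))" for n
      using add_add_minus[of "u n" "s n"] u(1)[of n] elemC[OF s, of n]
      by (simp add: u(2) add_commute mem_carrier)
    have "u \<in> cauchy_sequences Z M"
    proof (rule cauchyI[OF _ s s, of _ _ 1])
      show "range u \<subseteq> M" using u(1) by auto
      fix m n
      let ?x = "add Z (s m) (scale Z (-1) (s n))"
      have x: "?x \<in> carr Z" by (simp add: elemC[OF s] add_closed scale_closed)
      have "add Z (u m) (scale Z (-1) (u n)) = add Z (P ?x) (scale Z (-1) ?x)"
        by (simp add: u_eq P_add P_scale elemC[OF s] scale_closed scale_add P_closed add_closed
            add_add_swap)
      then have "?d (u m) (u n) \<le> nrm Z (P ?x) + nrm Z (scale Z (-1) ?x)"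
        using triangle[of "P ?x" "scale Z (-1) ?x"] x by (simp add: P_closed scale_closed)
      also have "\<dots> \<le> nrm Z ?x + nrm Z ?x"
        by (intro add_mono P_contractive nrm_minus_le x)
      finally show "?d (u m) (u n) \<le> 1 * ?d (s m) (s n) + ?d (s m) (s n)" by simp
    qed
    then show ?thesis using u by blast
  qed
  have lim: "(\<lambda>n. nrm Z (s n)) \<longlonglongrightarrow> lim (\<lambda>n. nrm Z (s n))"
    if s: "s \<in> cauchy_sequences Z (carr Z)" for s
  proof -
    have "Cauchy (\<lambda>n. nrm Z (s n))"
    proof (rule metric_CauchyI)
      fix e :: real assume "e > 0"
      then have "\<exists>N. \<forall>m\<ge>N. \<forall>n\<ge>N. ?d (s m) (s n) < e"
        using s by (simp add: cauchy_sequences_def)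
      moreover have "dist (nrm Z (s m)) (nrm Z (s n)) \<le> ?d (s m) (s n)" for m n
        using nrm_abs_diff_le[OF elemC[OF s] elemC[OF s]] by (simp add: dist_real_def)
      ultimately show "\<exists>N. \<forall>m\<ge>N. \<forall>n\<ge>N. dist (nrm Z (s m)) (nrm Z (s n)) < e"
        using order_le_less_trans by blast
    qed
    then show ?thesis by (simp add: Cauchy_convergent convergent_LIMSEQ_iff[symmetric])
  qed
  have lim_mono: "lim (\<lambda>n. nrm Z (s n)) \<le> y"
    if s: "s \<in> cauchy_sequences Z (carr Z)" and "b \<longlonglongrightarrow> y" and "\<And>n. nrm Z (s n) \<le> b n" for s b y
    using LIMSEQ_le[OF lim[OF s] that(2)] that(3) by blast
  have P_c: "(\<lambda>n. P (s n)) \<in> cauchy_sequences Z (carr Z)"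
    if s: "s \<in> cauchy_sequences Z (carr Z)" for s
  proof -
    obtain u where u: "u \<in> cauchy_sequences Z (carr Z)" "(\<lambda>n. P (s n)) = (\<lambda>n. add Z (s n) (u n))"
      using diff_P[OF s] mono by blast
    show ?thesis unfolding u(2) by (rule add_c[OF s u(1) order_refl add_closed])
  qed
  show ?thesis
  proof (unfold_locales, goal_cases)
    case 1 then show ?case by (simp add: cauchy_space_def const zero_closed)
  next
    case 2 then show ?case by (simp add: cauchy_space_def add_c add_closed)
  next
    case 3 then show ?case by (simp add: cauchy_space_def scale_c scale_closed)
  next
    case 4 then show ?case by (simp add: cauchy_space_def elemC zero_add)
  next
    case 5 then show ?case by (simp add: cauchy_space_def elemC add_assoc)
  next
    case 6 then show ?case by (simp add: cauchy_space_def elemC add_commute)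
  next
    case 7 then show ?case by (simp add: cauchy_space_def elemC scale_add)
  next
    case 8 then show ?case by (simp add: cauchy_space_def elemC add_scale)
  next
    case 9 then show ?case by (simp add: cauchy_space_def elemC scale_scale)
  next
    case 10 then show ?case by (simp add: cauchy_space_def elemC scale_one)
  next
    case 11 then show ?case by (simp add: cauchy_space_def elemC zero_scale)
  next
    case 12 then show ?case using mono by (simp add: cauchy_space_def)
  next
    case 13 then show ?case by (simp add: const zero_mem)
  next
    case 14 then show ?case by (simp add: cauchy_space_def add_c add_mem subset_carrier)
  next
    case 15 then show ?case by (simp add: cauchy_space_def scale_c scale_mem subset_carrier)
  next
    case 16 then show ?case by (simp add: cauchy_space_def elemC P_add)
  next
    case 17 then show ?case by (simp add: cauchy_space_def elemC P_scale)
  next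
    case 18 then show ?case by (simp add: elem P_mem)
  next
    case 19 then show ?case using diff_P by (simp add: cauchy_space_def)
  next
    case (20 s) then show ?case
      using lim_mono[OF P_c lim[of s]] by (simp add: cauchy_space_def P_contractive elemC)
  next
    case (21 s t)
    then have st: "s \<in> cauchy_sequences Z (carr Z)" "t \<in> cauchy_sequences Z (carr Z)"
      by (auto simp: cauchy_space_def)
    then show ?case
      using lim_mono[OF add_c[OF st] tendsto_add[OF lim[OF st(1)] lim[OF st(2)]]]
      by (simp add: cauchy_space_def triangle elemC add_closed)
  next
    case (22 s c)
    then have s: "s \<in> cauchy_sequences Z (carr Z)"
      by (auto simp: cauchy_space_def)
    then show ?case
      using lim_mono[OF scale_c[OF s] tendsto_mult_left[OF lim[OF s], of "\<bar>c\<bar>"]]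
      by (simp add: cauchy_space_def homogeneous elemC scale_closed)
  qed
qed

end



section \<open>Linear selections of metric projections\<close>

definition function_subspace :: "('i \<Rightarrow> 'a::real_vector) set \<Rightarrow> bool" where
  "function_subspace F \<longleftrightarrow> (\<lambda>_. 0) \<in> F \<and> (\<forall>f\<in>F. \<forall>g\<in>F. (\<lambda>i. f i + g i) \<in> F) \<and>
    (\<forall>c. \<forall>f\<in>F. (\<lambda>i. c *\<^sub>R f i) \<in> F)"

lemma function_space_vector_space:
  assumes "function_subspace F"
  shows "carrier_vector_space (function_space F N) (\<lambda>_. 0)"
  using assms
  by unfold_locales (auto simp: function_space_def function_subspace_def algebra_simps)

lemma function_subspaceI:
  assumes E: "subspace E"
    and "C (\<lambda>_. 0)" "\<And>f g. C f \<Longrightarrow> C g \<Longrightarrow> C (\<lambda>i. f i + g i)" "\<And>c f. C f \<Longrightarrow> C (\<lambda>i. c *\<^sub>R f i)"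
  shows "function_subspace {f. range f \<subseteq> E \<and> C f}"
  using assms(2-) subspace_0[OF E] subspace_add[OF E] subspace_mul[OF E]
  by (auto simp: function_subspace_def image_subset_iff)

text \<open>
  A nearest-point selection \<open>q\<close> has \<open>norm (x - q x) = infdist x J \<le> norm x\<close>, so the
  linear map \<open>x - q x\<close> is a contraction that vanishes on \<open>J\<close>, where the distance is 0; by the
  triangle inequality \<open>q\<close> is bounded by 2.
\<close>

locale linear_metric_selection =
  fixes J :: "'x::real_normed_vector set" and q :: "'x \<Rightarrow> 'x"
  assumes subspace_J: "subspace J" and selection: "linear_selection J q"
begin

definition p :: "'x \<Rightarrow> 'x" where "p x = x - q x"

lemma linear_q: "linear q"
  using selection by (simp add: linear_selection_def)

lemma q_mem: "q x \<in> J"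
  using selection by (simp add: linear_selection_def metric_projection_def)

lemma norm_p: "norm (p x) = infdist x J"
  using selection by (simp add: linear_selection_def metric_projection_def p_def)

lemma norm_p_le: "norm (p x) \<le> norm x"
  using infdist_le[OF subspace_0[OF subspace_J], of x] by (simp add: norm_p)

lemma norm_q_le: "norm (q x) \<le> 2 * norm x"
  using norm_triangle_ineq4[of x "p x"] norm_p_le[of x] by (simp add: p_def)

lemma p_mem: "x \<in> J \<Longrightarrow> p x = 0"
  using norm_p[of x] by simp

lemma bounded_linear_q: "bounded_linear q"
  using linear_q norm_q_le
  by (intro bounded_linear.intro bounded_linear_axioms.intro exI[of _ 2])
    (auto simp: mult.commute)

lemma bounded_linear_p: "bounded_linear p"
  unfolding p_def[abs_def] by (intro bounded_linear_sub bounded_linear_ident bounded_linear_q)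

text \<open>
  Applied pointwise, the contraction of \<open>X\<close> along \<open>J\<close> becomes one of a space of \<open>X\<close>-valued
  functions along the \<open>J\<close>-valued ones. The set \<open>A\<close> is for functions on a measure space, whose
  values are constrained on \<open>space \<mu>\<close> only: outside it a member of \<open>G\<close> may leave \<open>J\<close>, and
  so the map is set to 0 there in order to annihilate \<open>G\<close>.
\<close>

lemma function_space_lifting:
  fixes F G :: "('i \<Rightarrow> 'x) set"
  assumes F: "function_subspace F" and G: "function_subspace G" and "G \<subseteq> F"
    and vanish: "\<And>f i. f \<in> G \<Longrightarrow> i \<in> A \<Longrightarrow> f i \<in> J"
    and q: "\<And>f. f \<in> F \<Longrightarrow> (\<lambda>i. if i \<in> A then q (f i) else f i) \<in> G"
    and contractive: "\<And>f. f \<in> F \<Longrightarrow> N (\<lambda>i. if i \<in> A then p (f i) else 0) \<le> N f"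
  shows "contractive_lifting (function_space F N) (\<lambda>_. 0) G (\<lambda>f i. if i \<in> A then p (f i) else 0)"
proof -
  interpret carrier_vector_space "function_space F N" "\<lambda>_. 0"
    by (rule function_space_vector_space[OF F])
  interpret p: bounded_linear p by (rule bounded_linear_p)
  show ?thesis
  proof (unfold_locales, goal_cases)
    case (8 f)
    then have "(\<lambda>i. if i \<in> A then q (f i) else f i) \<in> G"
      using q by (simp add: function_space_def)
    then have "(\<lambda>i. (-1) *\<^sub>R (if i \<in> A then q (f i) else f i)) \<in> G"
      using G by (auto simp only: function_subspace_def)
    then show ?case
      by (rule rev_bexI) (auto simp: function_space_def p_def)
  qed (use G \<open>G \<subseteq> F\<close> in \<open>auto simp: function_space_def function_subspace_def p.add p.scaleR
      p_mem vanish contractive\<close>)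
qed

lemma pointwise_lifting:
  fixes F G :: "('i \<Rightarrow> 'x) set"
  assumes "function_subspace F" "function_subspace G" "G \<subseteq> F"
    and "\<And>f. f \<in> G \<Longrightarrow> range f \<subseteq> J"
    and "\<And>f. f \<in> F \<Longrightarrow> (\<lambda>i. q (f i)) \<in> G"
    and "\<And>f. f \<in> F \<Longrightarrow> N (\<lambda>i. p (f i)) \<le> N f"
  shows "QLP TYPE('v::banach) (function_space F N) G"
proof -
  interpret contractive_lifting "function_space F N" "\<lambda>_. 0" G "\<lambda>f i. if i \<in> UNIV then p (f i) else 0"
    using assms by (intro function_space_lifting) (auto simp: image_subset_iff)
  show ?thesis by (rule QLP)
qed

end


section \<open>Sequence spaces\<close>

lemma sup_norm_mono:
  assumes "bounded (range g)" and "\<And>i. norm (f i) \<le> norm (g i)"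
  shows "sup_norm f \<le> sup_norm g"
  unfolding sup_norm_def
proof (rule cSUP_mono)
  show "bdd_above (range (\<lambda>i. norm (g i)))"
    using assms(1) by (auto simp: bounded_iff intro: bdd_aboveI2)
qed (use assms in auto)

lemma summable_norm_powr_add:
  fixes x y :: "nat \<Rightarrow> 'x::real_normed_vector"
  assumes "r \<ge> 0" "summable (\<lambda>n. norm (x n) powr r)" "summable (\<lambda>n. norm (y n) powr r)"
  shows "summable (\<lambda>n. norm (x n + y n) powr r)"
proof (rule summable_comparison_test')
  show "summable (\<lambda>n. 2 powr r * (norm (x n) powr r + norm (y n) powr r))"
    by (intro summable_mult summable_add assms)
  fix n :: nat
  let ?m = "max (norm (x n)) (norm (y n))"
  have "norm (x n + y n) powr r \<le> (2 * ?m) powr r"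
    using norm_triangle_ineq[of "x n" "y n"] by (intro powr_mono2 assms) auto
  also have "\<dots> = 2 powr r * ?m powr r"
    by (simp add: powr_mult)
  also have "?m powr r \<le> norm (x n) powr r + norm (y n) powr r"
    by (simp add: max_def)
  finally show "norm (norm (x n + y n) powr r) \<le> 2 powr r * (norm (x n) powr r + norm (y n) powr r)"
    by simp
qed

lemma summable_norm_powr_bound:
  fixes x :: "nat \<Rightarrow> 'x::real_normed_vector" and y :: "nat \<Rightarrow> 'y::real_normed_vector"
  assumes "r \<ge> 0" "summable (\<lambda>n. norm (x n) powr r)" and "\<And>n. norm (y n) \<le> c * norm (x n)"
  shows "summable (\<lambda>n. norm (y n) powr r)"
proof (rule summable_comparison_test')
  show "summable (\<lambda>n. \<bar>c\<bar> powr r * norm (x n) powr r)"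
    by (intro summable_mult assms)
  fix n :: nat
  have "c * norm (x n) \<le> \<bar>c\<bar> * norm (x n)"
    by (simp add: mult_right_mono)
  then have "norm (y n) powr r \<le> (\<bar>c\<bar> * norm (x n)) powr r"
    using assms(3)[of n] by (intro powr_mono2 assms) auto
  then show "norm (norm (y n) powr r) \<le> \<bar>c\<bar> powr r * norm (x n) powr r"
    by (simp add: powr_mult)
qed

context linear_metric_selection
begin

lemma ell_QLP:
  assumes r: "r \<ge> 1"
  shows "QLP TYPE('v::banach) (ell_space r UNIV :: (nat \<Rightarrow> 'x) nspace) (carr (ell_space r J))"
proof -
  have sub: "function_subspace {x. range x \<subseteq> E \<and> summable (\<lambda>n. norm (x n) powr r)}"
    if E: "subspace E" for E :: "'x set"
  proof (intro function_subspaceI[OF E])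
    show "summable (\<lambda>n. norm (c *\<^sub>R x n) powr r)"
      if "summable (\<lambda>n. norm (x n) powr r)" for c and x :: "nat \<Rightarrow> 'x"
      using r by (intro summable_norm_powr_bound[OF _ that, where c = "\<bar>c\<bar>"]) auto
  qed (use r in \<open>auto intro: summable_norm_powr_add\<close>)
  show ?thesis
    unfolding ell_space_def function_space_def[of "{x. range x \<subseteq> J \<and> _ x}"] nspace.select_convs
  proof (intro pointwise_lifting sub subspace_UNIV subspace_J)
    fix x :: "nat \<Rightarrow> 'x"
    assume "x \<in> {x. range x \<subseteq> UNIV \<and> summable (\<lambda>n. norm (x n) powr r)}"
    then have x: "summable (\<lambda>n. norm (x n) powr r)" by simp
    show "(\<lambda>n. q (x n)) \<in> {x. range x \<subseteq> J \<and> summable (\<lambda>n. norm (x n) powr r)}"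
      using r q_mem norm_q_le by (auto intro!: summable_norm_powr_bound[OF _ x, where c = 2])
    have "summable (\<lambda>n. norm (p (x n)) powr r)"
      using r norm_p_le by (intro summable_norm_powr_bound[OF _ x, where c = 1]) auto
    then have "(\<Sum>n. norm (p (x n)) powr r) \<le> (\<Sum>n. norm (x n) powr r)"
      using x r norm_p_le by (intro suminf_le powr_mono2) auto
    moreover have "0 \<le> (\<Sum>n. norm (p (x n)) powr r)"
      by (intro suminf_nonneg \<open>summable (\<lambda>n. norm (p (x n)) powr r)\<close>) simp
    ultimately show "(\<Sum>n. norm (p (x n)) powr r) powr (1 / r) \<le> (\<Sum>n. norm (x n) powr r) powr (1 / r)"
      using r by (intro powr_mono2) auto
  qed auto
qed

lemma sup_norm_p_le: "bounded (range f) \<Longrightarrow> sup_norm (\<lambda>i. p (f i)) \<le> sup_norm f"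
  by (intro sup_norm_mono norm_p_le)

lemma bounded_range_q:
  assumes "bounded (range f)"
  shows "bounded (range (\<lambda>i. q (f i)))"
  using bounded_linear_image[OF assms bounded_linear_q] by (simp add: image_image)

lemma ell_infinity_QLP:
  "QLP TYPE('v::banach) (ell_infinity_space UNIV :: (nat \<Rightarrow> 'x) nspace) (carr (ell_infinity_space J))"
proof -
  have sub: "function_subspace {x :: nat \<Rightarrow> 'x. range x \<subseteq> E \<and> bounded (range x)}"
    if E: "subspace E" for E
    by (intro function_subspaceI[OF E]) (auto intro: bounded_plus_comp bounded_scaleR_comp)
  show ?thesis
    unfolding ell_infinity_space_def function_space_def[of "{x. range x \<subseteq> J \<and> _ x}"]
      nspace.select_convs
    by (intro pointwise_lifting sub subspace_UNIV subspace_J)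
      (auto simp: q_mem bounded_range_q sup_norm_p_le)
qed

lemma c0_QLP: "QLP TYPE('v::banach) (c0_space UNIV :: (nat \<Rightarrow> 'x) nspace) (carr (c0_space J))"
proof -
  have sub: "function_subspace {x :: nat \<Rightarrow> 'x. range x \<subseteq> E \<and> x \<longlonglongrightarrow> 0}"
    if E: "subspace E" for E
    by (intro function_subspaceI[OF E])
      (auto intro: tendsto_add_zero tendsto_scaleR[OF tendsto_const, where b = 0, simplified])
  show ?thesis
    unfolding c0_space_def function_space_def[of "{x. range x \<subseteq> J \<and> _ x}"] nspace.select_convs
    by (intro pointwise_lifting sub subspace_UNIV subspace_J)
      (auto simp: q_mem bounded_linear.tendsto_zero[OF bounded_linear_q]
        intro!: sup_norm_p_le convergent_imp_bounded)
qed

lemma c_QLP: "QLP TYPE('v::banach) (c_space UNIV :: (nat \<Rightarrow> 'x) nspace) (carr (c_space J))"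
proof -
  have sub: "function_subspace {x :: nat \<Rightarrow> 'x. range x \<subseteq> E \<and> (\<exists>l\<in>E. x \<longlonglongrightarrow> l)}"
    if E: "subspace E" for E
  proof (intro function_subspaceI[OF E])
    show "\<exists>l\<in>E. (\<lambda>_. 0) \<longlonglongrightarrow> l"
      using subspace_0[OF E] by blast
    show "\<exists>l\<in>E. (\<lambda>n. x n + y n) \<longlonglongrightarrow> l"
      if "\<exists>l\<in>E. x \<longlonglongrightarrow> l" "\<exists>l\<in>E. y \<longlonglongrightarrow> l" for x y
      using that subspace_add[OF E] tendsto_add by blast
    show "\<exists>l\<in>E. (\<lambda>n. c *\<^sub>R x n) \<longlonglongrightarrow> l" if "\<exists>l\<in>E. x \<longlonglongrightarrow> l" for c x
      using that subspace_mul[OF E] tendsto_scaleR[OF tendsto_const] by blast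
  qed
  show ?thesis
    unfolding c_space_def function_space_def[of "{x. range x \<subseteq> J \<and> _ x}"] nspace.select_convs
    by (intro pointwise_lifting sub subspace_UNIV subspace_J)
      (auto intro!: sup_norm_p_le q_mem
        intro: convergent_imp_bounded bounded_linear.tendsto[OF bounded_linear_q])
qed

end


section \<open>Continuous functions, Lipschitz functions and operators\<close>

lemma type_space_vector_space: "carrier_vector_space type_space 0"
  by unfold_locales (auto simp: type_space_def algebra_simps)

lemma lipschitz_constant_mono:
  assumes "\<exists>L. L-lipschitz_on UNIV g" and "\<And>L. L-lipschitz_on UNIV g \<Longrightarrow> L-lipschitz_on UNIV f"
  shows "lipschitz_constant f \<le> lipschitz_constant g"
  unfolding lipschitz_constant_def
  using assms by (intro cInf_superset_mono) (auto intro!: bdd_belowI[of _ 0] lipschitz_on_nonneg)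

lemma lipschitz_functions_subspace:
  assumes E: "subspace E"
  shows "function_subspace (lipschitz_functions E)"
  unfolding lipschitz_functions_def
  by (intro function_subspaceI[OF E])
    (auto intro: lipschitz_on_constant lipschitz_on_add lipschitz_on_cmult)

context linear_metric_selection
begin

text \<open>
  The contraction decreases both the supremum norm (finite since \<open>f\<close> is continuous on a compact
  space) and every Lipschitz bound, hence any monotone combination of the two.
\<close>

lemma lip_QLP:
  assumes "compact (UNIV :: 'k::metric_space set)"
    and N: "\<And>f g :: 'k \<Rightarrow> 'x. sup_norm f \<le> sup_norm g \<Longrightarrow>
      lipschitz_constant f \<le> lipschitz_constant g \<Longrightarrow> N f \<le> N g"
  shows "QLP TYPE('v::banach) (function_space (lipschitz_functions UNIV) N)
    (lipschitz_functions J :: ('k \<Rightarrow> 'x) set)"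
proof (intro pointwise_lifting lipschitz_functions_subspace subspace_UNIV subspace_J)
  fix f :: "'k \<Rightarrow> 'x"
  assume "f \<in> lipschitz_functions UNIV"
  then obtain L where L: "L-lipschitz_on UNIV f" by (auto simp: lipschitz_functions_def)
  obtain B where "B-lipschitz_on UNIV q"
    using bounded_linear.lipschitz_boundE[OF bounded_linear_q] by metis
  then have "(B * L)-lipschitz_on UNIV (\<lambda>i. q (f i))"
    by (intro lipschitz_on_compose2[OF L]) (auto intro: lipschitz_on_subset)
  then show "(\<lambda>i. q (f i)) \<in> lipschitz_functions J"
    by (auto simp: lipschitz_functions_def q_mem)
  have "bounded (range f)"
    using compact_continuous_image[OF lipschitz_on_continuous_on[OF L] assms(1)]
    by (rule compact_imp_bounded)
  moreover have "M-lipschitz_on UNIV (\<lambda>i. p (f i))" if M: "M-lipschitz_on UNIV f" for M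
  proof (rule lipschitz_onI[OF _ lipschitz_on_nonneg[OF M]])
    fix i j
    have "dist (p (f i)) (p (f j)) = norm (p (f i - f j))"
      by (simp add: dist_norm linear_diff[OF bounded_linear.linear[OF bounded_linear_p]])
    also have "\<dots> \<le> dist (f i) (f j)"
      by (simp add: dist_norm norm_p_le)
    also have "\<dots> \<le> M * dist i j"
      by (rule lipschitz_onD[OF M]) auto
    finally show "dist (p (f i)) (p (f j)) \<le> M * dist i j" .
  qed
  ultimately show "N (\<lambda>i. p (f i)) \<le> N f"
    using L by (intro N sup_norm_p_le lipschitz_constant_mono) auto
qed (auto simp: lipschitz_functions_def)

lemma lip_max_QLP:
  assumes "compact (UNIV :: 'k::metric_space set)"
  shows "QLP TYPE('v::banach) (lip_max_space UNIV :: ('k \<Rightarrow> 'x) nspace) (carr (lip_max_space J))"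
  using lip_QLP[OF assms max.mono]
  by (simp add: lip_max_space_def function_space_def)

lemma lip_sum_QLP:
  assumes "compact (UNIV :: 'k::metric_space set)"
  shows "QLP TYPE('v::banach) (lip_sum_space UNIV :: ('k \<Rightarrow> 'x) nspace) (carr (lip_sum_space J))"
  using lip_QLP[OF assms add_mono]
  by (simp add: lip_sum_space_def function_space_def)

lemma continuous_QLP:
  "QLP TYPE('v::banach) (type_space :: ('o::topological_space \<Rightarrow>\<^sub>C 'x) nspace)
    {f. range (apply_bcontfun f) \<subseteq> J}"
proof -
  interpret p: bounded_linear p by (rule bounded_linear_p)
  interpret carrier_vector_space "type_space :: ('o \<Rightarrow>\<^sub>C 'x) nspace" 0
    by (rule type_space_vector_space)
  define P :: "('o \<Rightarrow>\<^sub>C 'x) \<Rightarrow> 'o \<Rightarrow>\<^sub>C 'x" where "P f = Bcontfun (\<lambda>i. p (apply_bcontfun f i))" for f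
  have P: "apply_bcontfun (P f) i = p (apply_bcontfun f i)" for f i
  proof -
    have "(\<lambda>i. p (apply_bcontfun f i)) \<in> bcontfun"
      using order_trans[OF norm_p_le norm_bounded[of f]]
      by (intro bcontfun_normI p.continuous_on) auto
    then show ?thesis by (simp add: P_def Bcontfun_inverse)
  qed
  interpret contractive_lifting type_space 0 "{f :: 'o \<Rightarrow>\<^sub>C 'x. range (apply_bcontfun f) \<subseteq> J}" P
  proof (unfold_locales, goal_cases)
    case (8 f)
    have "P f - f \<in> {f. range (apply_bcontfun f) \<subseteq> J}"
      by (auto simp: P p_def subspace_neg[OF subspace_J] q_mem)
    then show ?case by (rule rev_bexI) (simp add: type_space_def)
  next
    case (9 f)
    show ?case
      using order_trans[OF norm_p_le norm_bounded[of f]]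
      by (auto simp: type_space_def P intro!: norm_bound)
  qed (auto simp: type_space_def subspace_0[OF subspace_J] P p.add p.scaleR image_subset_iff
      intro!: bcontfun_eqI p_mem intro: subspace_add[OF subspace_J] subspace_mul[OF subspace_J])
  show ?thesis by (rule QLP)
qed

lemma operator_QLP:
  "QLP TYPE('v::banach) (type_space :: ('y::real_normed_vector \<Rightarrow>\<^sub>L 'x) nspace)
    {A. range (blinfun_apply A) \<subseteq> J}"
proof -
  interpret carrier_vector_space "type_space :: ('y \<Rightarrow>\<^sub>L 'x) nspace" 0
    by (rule type_space_vector_space)
  interpret p: bounded_linear p by (rule bounded_linear_p)
  define P :: "('y \<Rightarrow>\<^sub>L 'x) \<Rightarrow> 'y \<Rightarrow>\<^sub>L 'x" where "P A = Blinfun p o\<^sub>L A" for A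
  have P: "blinfun_apply (P A) y = p (blinfun_apply A y)" for A y
    by (simp add: P_def bounded_linear_Blinfun_apply[OF bounded_linear_p])
  interpret contractive_lifting type_space 0 "{A :: 'y \<Rightarrow>\<^sub>L 'x. range (blinfun_apply A) \<subseteq> J}" P
  proof (unfold_locales, goal_cases)
    case (8 A)
    have "P A - A \<in> {A. range (blinfun_apply A) \<subseteq> J}"
      by (auto simp: P p_def blinfun.diff_left subspace_neg[OF subspace_J] q_mem)
    then show ?case by (rule rev_bexI) (simp add: type_space_def)
  next
    case (9 A)
    show ?case
      using order_trans[OF norm_p_le norm_blinfun[of A]]
      by (auto simp: type_space_def P intro!: norm_blinfun_bound)
  qed (auto simp: type_space_def subspace_0[OF subspace_J] P p.add p.scaleR image_subset_iff
      blinfun.add_left blinfun.scaleR_left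
      intro!: blinfun_eqI p_mem intro: subspace_add[OF subspace_J] subspace_mul[OF subspace_J])
  show ?thesis by (rule QLP)
qed

end



section \<open>Strongly measurable functions\<close>

lemma strongly_measurable_cong:
  assumes "\<And>\<omega>. \<omega> \<in> space \<mu> \<Longrightarrow> f \<omega> = g \<omega>"
  shows "strongly_measurable \<mu> E f \<longleftrightarrow> strongly_measurable \<mu> E g"
proof -
  have "(AE \<omega> in \<mu>. (\<lambda>i::nat. s i \<omega>) \<longlonglongrightarrow> f \<omega>) \<longleftrightarrow> (AE \<omega> in \<mu>. (\<lambda>i. s i \<omega>) \<longlonglongrightarrow> g \<omega>)" for s
    by (rule AE_cong) (simp add: assms)
  moreover have "f ` space \<mu> = g ` space \<mu>"
    by (intro image_cong refl assms)
  ultimately show ?thesis by (simp add: strongly_measurable_def)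
qed

lemma strongly_measurable_const: "c \<in> E \<Longrightarrow> strongly_measurable \<mu> E (\<lambda>_. c)"
  by (auto simp: strongly_measurable_def intro!: exI[of _ "\<lambda>_ _. c"])

text \<open>
  The approximating simple functions are transformed along with the limits, and stay in the
  prescribed set of values because \<open>h\<close> maps \<open>E\<close> and \<open>E'\<close> into \<open>E''\<close>.
\<close>

lemma strongly_measurable_map2:
  assumes f: "strongly_measurable \<mu> E f" and g: "strongly_measurable \<mu> E' g"
    and h_mem: "\<And>x y. x \<in> E \<Longrightarrow> y \<in> E' \<Longrightarrow> h x y \<in> E''"
    and h_tendsto: "\<And>x y s t. s \<longlonglongrightarrow> x \<Longrightarrow> t \<longlonglongrightarrow> y \<Longrightarrow> (\<lambda>n::nat. h (s n) (t n)) \<longlonglongrightarrow> h x y"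
  shows "strongly_measurable \<mu> E'' (\<lambda>\<omega>. h (f \<omega>) (g \<omega>))"
proof -
  obtain s where s: "\<And>i. simple_function \<mu> (s i)" "\<And>i. s i ` space \<mu> \<subseteq> E"
    "AE \<omega> in \<mu>. (\<lambda>i::nat. s i \<omega>) \<longlonglongrightarrow> f \<omega>"
    using f unfolding strongly_measurable_def by blast
  obtain t where t: "\<And>i. simple_function \<mu> (t i)" "\<And>i. t i ` space \<mu> \<subseteq> E'"
    "AE \<omega> in \<mu>. (\<lambda>i::nat. t i \<omega>) \<longlonglongrightarrow> g \<omega>"
    using g unfolding strongly_measurable_def by blast
  have "AE \<omega> in \<mu>. (\<lambda>i. h (s i \<omega>) (t i \<omega>)) \<longlonglongrightarrow> h (f \<omega>) (g \<omega>)"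
    using s(3) t(3) by eventually_elim (rule h_tendsto)
  moreover have "simple_function \<mu> (\<lambda>\<omega>. h (s i \<omega>) (t i \<omega>))" for i
    by (rule simple_function_compose2[OF s(1) t(1)])
  moreover have "(\<lambda>\<omega>. h (s i \<omega>) (t i \<omega>)) ` space \<mu> \<subseteq> E''" for i
    using s(2)[of i] t(2)[of i] h_mem by (auto simp: image_subset_iff)
  moreover have "(\<lambda>\<omega>. h (f \<omega>) (g \<omega>)) ` space \<mu> \<subseteq> E''"
    using f g h_mem by (auto simp: strongly_measurable_def image_subset_iff)
  ultimately show ?thesis
    unfolding strongly_measurable_def by (intro conjI exI[of _ "\<lambda>i \<omega>. h (s i \<omega>) (t i \<omega>)"]) auto
qed

lemma strongly_measurable_map:
  assumes "strongly_measurable \<mu> E f" and "\<And>x. x \<in> E \<Longrightarrow> h x \<in> E'"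
    and "continuous_on UNIV h"
  shows "strongly_measurable \<mu> E' (\<lambda>\<omega>. h (f \<omega>))"
proof (rule strongly_measurable_map2[OF assms(1) assms(1)])
  show "(\<lambda>n. h (s n)) \<longlonglongrightarrow> h x" if "s \<longlonglongrightarrow> x" for s :: "nat \<Rightarrow> _" and x
    using continuous_on_tendsto_compose[OF assms(3) that] by simp
qed (rule assms(2))

lemma strongly_measurable_mono: "strongly_measurable \<mu> E f \<Longrightarrow> E \<subseteq> E' \<Longrightarrow> strongly_measurable \<mu> E' f"
  using strongly_measurable_map[OF _ _ continuous_on_id] by blast

text \<open>
  Convergence holds only almost everywhere, so the norm agrees with a measurable limit up to a null
  set, which the completion makes measurable.
\<close>

lemma borel_measurable_completion_norm:
  assumes "strongly_measurable \<mu> E f"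
  shows "(\<lambda>\<omega>. norm (f \<omega>)) \<in> borel_measurable (completion \<mu>)"
proof -
  obtain s where s: "\<And>i. simple_function \<mu> (s i)" "AE \<omega> in \<mu>. (\<lambda>i::nat. s i \<omega>) \<longlonglongrightarrow> f \<omega>"
    using assms unfolding strongly_measurable_def by blast
  define L where "L \<omega> = lim (\<lambda>i. norm (s i \<omega>))" for \<omega>
  have "L \<in> borel_measurable \<mu>"
    unfolding L_def[abs_def]
    by (rule borel_measurable_lim_metric, rule borel_measurable_simple_function,
        rule simple_function_compose1[OF s(1)])
  then have L: "L \<in> borel_measurable (completion \<mu>)"
    by (rule measurable_completion)
  have eq: "AE \<omega> in completion \<mu>. L \<omega> = norm (f \<omega>)"
    using AE_completion[OF s(2)] by eventually_elim (simp add: L_def limI tendsto_norm)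
  show ?thesis
  proof (rule measurableI)
    fix A :: "real set" assume "A \<in> sets borel"
    then have sets: "L -` A \<inter> space (completion \<mu>) \<in> sets (completion \<mu>)"
      by (rule measurable_sets[OF L])
    have ae: "AE \<omega> in completion \<mu>. \<omega> \<in> L -` A \<inter> space (completion \<mu>) \<longleftrightarrow>
        \<omega> \<in> (\<lambda>\<omega>. norm (f \<omega>)) -` A \<inter> space (completion \<mu>)"
      using eq by eventually_elim simp
    show "(\<lambda>\<omega>. norm (f \<omega>)) -` A \<inter> space (completion \<mu>) \<in> sets (completion \<mu>)"
      by (rule completion.in_sets_AE[OF ae sets]) auto
  qed simp
qed


section \<open>Bochner integrable functions\<close>

lemma bochner_functions_cong:
  assumes "\<And>\<omega>. \<omega> \<in> space \<mu> \<Longrightarrow> f \<omega> = g \<omega>"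
  shows "f \<in> bochner_functions \<mu> E \<longleftrightarrow> g \<in> bochner_functions \<mu> E"
proof -
  have "integrable (completion \<mu>) (\<lambda>\<omega>. norm (f \<omega>)) \<longleftrightarrow> integrable (completion \<mu>) (\<lambda>\<omega>. norm (g \<omega>))"
    using assms by (intro Bochner_Integration.integrable_cong) auto
  then show ?thesis
    by (simp add: bochner_functions_def strongly_measurable_cong[OF assms])
qed

lemma bochner_functions_map:
  assumes f: "f \<in> bochner_functions \<mu> E" and h: "bounded_linear h" "\<And>x. x \<in> E \<Longrightarrow> h x \<in> E'"
  shows "(\<lambda>\<omega>. h (f \<omega>)) \<in> bochner_functions \<mu> E'"
proof -
  have sm: "strongly_measurable \<mu> E' (\<lambda>\<omega>. h (f \<omega>))"
    using f by (intro strongly_measurable_map[OF _ h(2) linear_continuous_on[OF h(1)]])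
      (simp_all add: bochner_functions_def)
  obtain K where K: "\<And>x. norm (h x) \<le> norm x * K"
    using bounded_linear.bounded[OF h(1)] by blast
  have "integrable (completion \<mu>) (\<lambda>\<omega>. norm (f \<omega>) * K)"
    using f by (simp add: bochner_functions_def)
  then have "integrable (completion \<mu>) (\<lambda>\<omega>. norm (h (f \<omega>)))"
    by (rule Bochner_Integration.integrable_bound)
      (use order_trans[OF K abs_ge_self] in
        \<open>auto intro!: AE_I2 borel_measurable_completion_norm[OF sm]\<close>)
  then show ?thesis using sm by (simp add: bochner_functions_def)
qed

lemma bochner_functions_subspace:
  fixes E :: "'x::real_normed_vector set"
  assumes E: "subspace E"
  shows "function_subspace (bochner_functions \<mu> E)"
proof -
  have "(\<lambda>\<omega>. f \<omega> + g \<omega>) \<in> bochner_functions \<mu> E"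
    if f: "f \<in> bochner_functions \<mu> E" and g: "g \<in> bochner_functions \<mu> E" for f g
  proof -
    have sm: "strongly_measurable \<mu> E (\<lambda>\<omega>. f \<omega> + g \<omega>)"
      using f g
      by (intro strongly_measurable_map2[OF _ _ subspace_add[OF E] tendsto_add])
        (simp_all add: bochner_functions_def)
    have "integrable (completion \<mu>) (\<lambda>\<omega>. norm (f \<omega>) + norm (g \<omega>))"
      using f g by (simp add: bochner_functions_def)
    then have "integrable (completion \<mu>) (\<lambda>\<omega>. norm (f \<omega> + g \<omega>))"
      by (rule Bochner_Integration.integrable_bound)
        (auto intro!: AE_I2 borel_measurable_completion_norm[OF sm] norm_triangle_ineq)
    then show ?thesis using sm by (simp add: bochner_functions_def)
  qed
  moreover have "(\<lambda>_. 0) \<in> bochner_functions \<mu> E"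
    using subspace_0[OF E] by (simp add: bochner_functions_def strongly_measurable_const)
  moreover have "(\<lambda>\<omega>. c *\<^sub>R f \<omega>) \<in> bochner_functions \<mu> E" if "f \<in> bochner_functions \<mu> E" for c f
    using bochner_functions_map[OF that bounded_linear_scaleR_right] subspace_mul[OF E] by blast
  ultimately show ?thesis by (simp add: function_subspace_def)
qed

lemma bochner_functions_mono: "E \<subseteq> E' \<Longrightarrow> bochner_functions \<mu> E \<subseteq> bochner_functions \<mu> E'"
  by (auto simp: bochner_functions_def intro: strongly_measurable_mono)

lemma bochner_seminormed_space:
  "carrier_seminormed_space (bochner_seminormed \<mu> :: ('m \<Rightarrow> 'x::real_normed_vector) nspace) (\<lambda>_. 0)"
proof -
  interpret carrier_vector_space "bochner_seminormed \<mu> :: ('m \<Rightarrow> 'x) nspace" "\<lambda>_. 0"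
    unfolding bochner_seminormed_def
    by (intro function_space_vector_space bochner_functions_subspace subspace_UNIV)
  show ?thesis
  proof
    fix f g :: "'m \<Rightarrow> 'x"
    assume f: "f \<in> carr (bochner_seminormed \<mu>)" and g: "g \<in> carr (bochner_seminormed \<mu>)"
    have "add (bochner_seminormed \<mu>) f g \<in> carr (bochner_seminormed \<mu>)"
      using f g by (rule add_closed)
    then have "(\<integral>\<omega>. norm (f \<omega> + g \<omega>) \<partial>completion \<mu>) \<le> (\<integral>\<omega>. norm (f \<omega>) + norm (g \<omega>) \<partial>completion \<mu>)"
      using f g by (intro integral_mono norm_triangle_ineq)
        (auto simp: bochner_seminormed_def function_space_def bochner_functions_def)
    also have "\<dots> = (\<integral>\<omega>. norm (f \<omega>) \<partial>completion \<mu>) + (\<integral>\<omega>. norm (g \<omega>) \<partial>completion \<mu>)"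
      using f g by (intro Bochner_Integration.integral_add)
        (auto simp: bochner_seminormed_def function_space_def bochner_functions_def)
    finally show "nrm (bochner_seminormed \<mu>) (add (bochner_seminormed \<mu>) f g) \<le>
        nrm (bochner_seminormed \<mu>) f + nrm (bochner_seminormed \<mu>) g"
      by (simp add: bochner_seminormed_def function_space_def)
  qed (simp add: bochner_seminormed_def function_space_def)
qed

context linear_metric_selection
begin

lemma bochner_lifting:
  fixes \<mu> :: "'m measure"
  shows
  "contractive_lifting (bochner_seminormed \<mu>) (\<lambda>_. 0) (bochner_functions \<mu> J)
    (\<lambda>f \<omega>. if \<omega> \<in> space \<mu> then p (f \<omega>) else 0)"
  unfolding bochner_seminormed_def
proof (intro function_space_lifting bochner_functions_subspace subspace_UNIV subspace_J
    bochner_functions_mono)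
  fix f :: "'m \<Rightarrow> 'x" assume f: "f \<in> bochner_functions \<mu> UNIV"
  have "(\<lambda>\<omega>. q (f \<omega>)) \<in> bochner_functions \<mu> J"
    by (intro bochner_functions_map[OF f bounded_linear_q] q_mem)
  then show "(\<lambda>\<omega>. if \<omega> \<in> space \<mu> then q (f \<omega>) else f \<omega>) \<in> bochner_functions \<mu> J"
    by (subst bochner_functions_cong) auto
  have "(\<integral>\<omega>. norm (if \<omega> \<in> space \<mu> then p (f \<omega>) else 0) \<partial>completion \<mu>) =
      (\<integral>\<omega>. norm (p (f \<omega>)) \<partial>completion \<mu>)"
    by (intro Bochner_Integration.integral_cong) auto
  also have "\<dots> \<le> (\<integral>\<omega>. norm (f \<omega>) \<partial>completion \<mu>)"
    using f bochner_functions_map[OF f bounded_linear_p, of UNIV]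
    by (intro integral_mono norm_p_le) (auto simp: bochner_functions_def)
  finally show "(\<integral>\<omega>. norm (if \<omega> \<in> space \<mu> then p (f \<omega>) else 0) \<partial>completion \<mu>)
      \<le> (\<integral>\<omega>. norm (f \<omega>) \<partial>completion \<mu>)" .
qed (auto simp: bochner_functions_def strongly_measurable_def)

lemma L1_QLP: "QLP TYPE('v::banach) (L1_space \<mu>) (L1_subspace \<mu> J)"
proof -
  interpret contractive_lifting "bochner_seminormed \<mu>" "\<lambda>_. 0" "bochner_functions \<mu> J"
    "\<lambda>f \<omega>. if \<omega> \<in> space \<mu> then p (f \<omega>) else 0"
    by (rule bochner_lifting)
  interpret seminormed_contractive_lifting "bochner_seminormed \<mu>" "\<lambda>_. 0" "bochner_functions \<mu> J"
    "\<lambda>f \<omega>. if \<omega> \<in> space \<mu> then p (f \<omega>) else 0"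
    by (intro seminormed_contractive_lifting.intro bochner_seminormed_space contractive_lifting_axioms)
  show ?thesis
    unfolding L1_space_def L1_subspace_def by (rule contractive_lifting.QLP[OF quotient_lifting])
qed

end


section \<open>Pettis integrable functions\<close>

text \<open>
  By Baire's theorem one of the closed sublevel sets contains a ball; by translation \<open>N\<close> is bounded
  on a ball around 0, and by homogeneity everywhere.
\<close>

lemma seminorm_bounded_of_closed_sublevels:
  fixes N :: "'b::banach \<Rightarrow> real"
  assumes diff: "\<And>x y. N (x - y) \<le> N x + N y"
    and scale: "\<And>c x. N (c *\<^sub>R x) \<le> \<bar>c\<bar> * N x"
    and closed: "\<And>n::nat. closed {x. N x \<le> real n}"
  shows "\<exists>K. \<forall>x. N x \<le> K * norm x"
proof -
  have "\<exists>n::nat. interior {x. N x \<le> real n} \<noteq> {}"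
  proof (rule ccontr)
    assume "\<not> ?thesis"
    then have "euclidean interior_of \<Union> (range (\<lambda>n::nat. {x. N x \<le> real n})) = {}"
      by (intro Baire_category_alt) (auto simp: completely_metrizable_space_euclidean closed)
    moreover have "\<Union> (range (\<lambda>n::nat. {x. N x \<le> real n})) = UNIV"
      using real_arch_simple by auto
    ultimately show False by simp
  qed
  then obtain n :: nat and a e where e: "e > 0" and ball: "ball a e \<subseteq> {x. N x \<le> real n}"
    by (metis all_not_in_conv mem_interior)
  have small: "N y \<le> 2 * n" if "norm y < e" for y
  proof -
    have "a + y \<in> ball a e" "a \<in> ball a e" using that e by (auto simp: dist_norm)
    then have "N (a + y) \<le> n" "N a \<le> n" using ball by blast+
    then show ?thesis using diff[of "a + y" a] by simp
  qed
  have "N x \<le> (4 * n / e) * norm x" for x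
  proof (cases "x = 0")
    case True then show ?thesis using scale[of 0 0] by simp
  next
    case False
    define c where "c = e / (2 * norm x)"
    have c: "c > 0" using e False by (simp add: c_def)
    have "norm (c *\<^sub>R x) < e" using e False by (simp add: c_def)
    then have "N (c *\<^sub>R x) \<le> 2 * n" by (rule small)
    then have "inverse c * N (c *\<^sub>R x) \<le> inverse c * (2 * n)"
      using c by (intro mult_left_mono) auto
    moreover have "N x \<le> inverse c * N (c *\<^sub>R x)"
      using scale[of "inverse c" "c *\<^sub>R x"] c by simp
    moreover have "inverse c * (2 * n) = (4 * n / e) * norm x"
      using False e by (simp add: c_def field_simps)
    ultimately show ?thesis by linarith
  qed
  then show ?thesis by blast
qed

lemma functional_on_blinfun: "functional_on E (blinfun_apply \<phi>)"
  unfolding functional_on_def using norm_blinfun[of \<phi>]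
  by (auto simp: blinfun.add_right blinfun.scaleR_right intro!: exI[of _ "norm \<phi>"])

lemma functional_on_compose:
  assumes \<phi>: "functional_on E' \<phi>" and h: "bounded_linear h" "\<And>x. x \<in> E \<Longrightarrow> h x \<in> E'"
  shows "functional_on E (\<lambda>x. \<phi> (h x))"
proof -
  interpret h: bounded_linear h by (rule h)
  obtain K where K: "\<And>x. x \<in> E' \<Longrightarrow> \<bar>\<phi> x\<bar> \<le> K * norm x"
    using \<phi> unfolding functional_on_def by blast
  obtain B where B: "\<And>x. norm (h x) \<le> norm x * B"
    using h.bounded by blast
  have "\<bar>\<phi> (h x)\<bar> \<le> (\<bar>K\<bar> * B) * norm x" if "x \<in> E" for x
  proof -
    have "\<bar>\<phi> (h x)\<bar> \<le> K * norm (h x)" using K h(2) that by blast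
    also have "\<dots> \<le> \<bar>K\<bar> * norm (h x)" by (intro mult_right_mono) auto
    also have "\<dots> \<le> \<bar>K\<bar> * (norm x * B)" by (intro mult_left_mono B) auto
    finally show ?thesis by (simp add: mult_ac)
  qed
  then show ?thesis
    using \<phi> h(2) by (auto simp: functional_on_def h.add h.scaleR)
qed

lemma pettis_functions_cong:
  assumes "\<And>\<omega>. \<omega> \<in> space \<mu> \<Longrightarrow> f \<omega> = g \<omega>"
  shows "f \<in> pettis_functions \<mu> E \<longleftrightarrow> g \<in> pettis_functions \<mu> E"
proof -
  have 1: "integrable (completion \<mu>) (\<lambda>\<omega>. \<phi> (f \<omega>)) \<longleftrightarrow> integrable (completion \<mu>) (\<lambda>\<omega>. \<phi> (g \<omega>))"
    for \<phi> :: "'b \<Rightarrow> real"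
    using assms by (intro Bochner_Integration.integrable_cong) auto
  have 2: "(LINT \<omega>:A|completion \<mu>. \<phi> (f \<omega>)) = (LINT \<omega>:A|completion \<mu>. \<phi> (g \<omega>))"
    for A and \<phi> :: "'b \<Rightarrow> real"
    using assms unfolding set_lebesgue_integral_def
    by (intro Bochner_Integration.integral_cong) auto
  have 3: "strongly_measurable \<mu> E f \<longleftrightarrow> strongly_measurable \<mu> E g"
    by (rule strongly_measurable_cong[OF assms])
  show ?thesis
    unfolding pettis_functions_def mem_Collect_eq 1 2 3 ..
qed

text \<open>
  Composing a functional with \<open>h\<close> gives a functional, so integrability is inherited and \<open>h\<close>
  maps the Pettis integral of \<open>f\<close> to that of \<open>h \<circ> f\<close>.
\<close>

lemma pettis_functions_map:
  assumes f: "f \<in> pettis_functions \<mu> E" and h: "bounded_linear h" "\<And>x. x \<in> E \<Longrightarrow> h x \<in> E'"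
  shows "(\<lambda>\<omega>. h (f \<omega>)) \<in> pettis_functions \<mu> E'"
  unfolding pettis_functions_def
proof (intro CollectI conjI allI impI ballI)
  have comp: "functional_on E (\<lambda>x. \<phi> (h x))" if "functional_on E' \<phi>" for \<phi>
    by (rule functional_on_compose[OF that h])
  show "strongly_measurable \<mu> E' (\<lambda>\<omega>. h (f \<omega>))"
    using f by (intro strongly_measurable_map[OF _ h(2) linear_continuous_on[OF h(1)]])
      (simp_all add: pettis_functions_def)
  have "integrable (completion \<mu>) (\<lambda>\<omega>. \<psi> (f \<omega>))" if "functional_on E \<psi>" for \<psi>
    using f that by (simp add: pettis_functions_def)
  then show "integrable (completion \<mu>) (\<lambda>\<omega>. \<phi> (h (f \<omega>)))" if "functional_on E' \<phi>" for \<phi>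
    by this (rule comp[OF that])
  fix A assume "A \<in> sets \<mu>"
  then obtain v where v: "v \<in> E"
    "\<And>\<phi>. functional_on E \<phi> \<Longrightarrow> \<phi> v = (LINT \<omega>:A|completion \<mu>. \<phi> (f \<omega>))"
    using f by (auto simp: pettis_functions_def)
  have "\<phi> (h v) = (LINT \<omega>:A|completion \<mu>. \<phi> (h (f \<omega>)))" if "functional_on E' \<phi>" for \<phi>
    by (rule v(2)[OF comp[OF that]])
  then show "\<exists>v\<in>E'. \<forall>\<phi>. functional_on E' \<phi> \<longrightarrow> \<phi> v = (LINT \<omega>:A|completion \<mu>. \<phi> (h (f \<omega>)))"
    using h(2)[OF v(1)] by blast
qed

lemma pettis_functions_mono: "E \<subseteq> E' \<Longrightarrow> pettis_functions \<mu> E \<subseteq> pettis_functions \<mu> E'"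
  using pettis_functions_map[OF _ bounded_linear_ident, of _ \<mu> E E'] by auto

lemma pettis_functions_subspace:
  fixes E :: "'x::real_normed_vector set"
  assumes E: "subspace E"
  shows "function_subspace (pettis_functions \<mu> E)"
proof -
  have zero: "\<phi> 0 = 0" if "functional_on E \<phi>" for \<phi>
    using that subspace_0[OF E] unfolding functional_on_def by (metis add_cancel_right_right)
  have "(\<lambda>_. 0) \<in> pettis_functions \<mu> E"
    using subspace_0[OF E]
    by (auto simp: pettis_functions_def strongly_measurable_const zero set_lebesgue_integral_def
        intro!: bexI[of _ 0])
  moreover have "(\<lambda>\<omega>. c *\<^sub>R f \<omega>) \<in> pettis_functions \<mu> E" if "f \<in> pettis_functions \<mu> E" for c f
    using pettis_functions_map[OF that bounded_linear_scaleR_right] subspace_mul[OF E] by blast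
  moreover have "(\<lambda>\<omega>. f \<omega> + g \<omega>) \<in> pettis_functions \<mu> E"
    if f: "f \<in> pettis_functions \<mu> E" and g: "g \<in> pettis_functions \<mu> E" for f g
    unfolding pettis_functions_def
  proof (intro CollectI conjI allI impI ballI)
    have sm: "strongly_measurable \<mu> E f" "strongly_measurable \<mu> E g"
      using f g by (auto simp: pettis_functions_def)
    show "strongly_measurable \<mu> E (\<lambda>\<omega>. f \<omega> + g \<omega>)"
      by (rule strongly_measurable_map2[OF sm subspace_add[OF E] tendsto_add])
    have mem: "f \<omega> \<in> E" "g \<omega> \<in> E" if "\<omega> \<in> space \<mu>" for \<omega>
      using sm that by (auto simp: strongly_measurable_def)
    have int: "integrable (completion \<mu>) (\<lambda>\<omega>. \<phi> (f \<omega>))" "integrable (completion \<mu>) (\<lambda>\<omega>. \<phi> (g \<omega>))"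
      if "functional_on E \<phi>" for \<phi>
      using f g that by (auto simp: pettis_functions_def)
    have add: "\<phi> (x + y) = \<phi> x + \<phi> y" if "functional_on E \<phi>" "x \<in> E" "y \<in> E" for \<phi> x y
      using that by (simp add: functional_on_def)
    show "integrable (completion \<mu>) (\<lambda>\<omega>. \<phi> (f \<omega> + g \<omega>))" if \<phi>: "functional_on E \<phi>" for \<phi>
      using Bochner_Integration.integrable_add[OF int[OF \<phi>]]
      by (rule Bochner_Integration.integrable_cong[THEN iffD1, rotated 2]) (auto simp: add[OF \<phi>] mem)
    fix A assume A: "A \<in> sets \<mu>"
    obtain v where v: "v \<in> E"
      "\<And>\<phi>. functional_on E \<phi> \<Longrightarrow> \<phi> v = (LINT \<omega>:A|completion \<mu>. \<phi> (f \<omega>))"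
      using f A by (auto simp: pettis_functions_def)
    obtain w where w: "w \<in> E"
      "\<And>\<phi>. functional_on E \<phi> \<Longrightarrow> \<phi> w = (LINT \<omega>:A|completion \<mu>. \<phi> (g \<omega>))"
      using g A by (auto simp: pettis_functions_def)
    have "\<phi> (v + w) = (LINT \<omega>:A|completion \<mu>. \<phi> (f \<omega> + g \<omega>))" if \<phi>: "functional_on E \<phi>" for \<phi>
    proof -
      have "\<phi> (v + w) = (LINT \<omega>:A|completion \<mu>. \<phi> (f \<omega>) + \<phi> (g \<omega>))"
        using int[OF \<phi>] A
        by (simp add: add[OF \<phi>] v w \<phi> set_integral_add set_integrable_def
            integrable_mult_indicator del: integrable_real_mult_indicator real_scaleR_def)
      also have "\<dots> = (LINT \<omega>:A|completion \<mu>. \<phi> (f \<omega> + g \<omega>))"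
        unfolding set_lebesgue_integral_def
        by (intro Bochner_Integration.integral_cong refl) (simp add: add[OF \<phi>] mem)
      finally show ?thesis .
    qed
    then show "\<exists>v\<in>E. \<forall>\<phi>. functional_on E \<phi> \<longrightarrow> \<phi> v = (LINT \<omega>:A|completion \<mu>. \<phi> (f \<omega> + g \<omega>))"
      using subspace_add[OF E v(1) w(1)] by blast
  qed
  ultimately show ?thesis by (simp add: function_subspace_def)
qed

lemma pettis_integrable:
  fixes f :: "'m \<Rightarrow> 'x::real_normed_vector" and \<phi> :: "'x \<Rightarrow>\<^sub>L real"
  assumes "f \<in> pettis_functions \<mu> UNIV"
  shows "integrable (completion \<mu>) (\<lambda>\<omega>. blinfun_apply \<phi> (f \<omega>))"
  using assms functional_on_blinfun[of UNIV \<phi>] by (simp add: pettis_functions_def)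

text \<open>
  The supremum defining the Pettis norm is finite, which is what makes the norm monotone and
  subadditive. The function \<open>\<phi> \<mapsto> \<integral>\<bar>\<phi> \<circ> f\<bar>\<close> is a finite seminorm on the dual
  space; its sublevel sets are closed by Fatou's lemma, since norm convergence of functionals implies
  pointwise convergence of the integrands. The dual is complete, so the seminorm is bounded on the unit
  ball.
\<close>

lemma pettis_norm_bdd_above:
  fixes f :: "'m \<Rightarrow> 'x::real_normed_vector"
  assumes f: "f \<in> pettis_functions \<mu> UNIV"
  shows "bdd_above ((\<lambda>\<phi>. \<integral>\<omega>. \<bar>blinfun_apply \<phi> (f \<omega>)\<bar> \<partial>completion \<mu>) ` {\<phi> :: 'x \<Rightarrow>\<^sub>L real. norm \<phi> \<le> 1})"
proof -
  define N where "N \<phi> = (\<integral>\<omega>. \<bar>blinfun_apply \<phi> (f \<omega>)\<bar> \<partial>completion \<mu>)" for \<phi> :: "'x \<Rightarrow>\<^sub>L real"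
  note int = pettis_integrable[OF f]
  have "\<exists>K. \<forall>\<phi>. N \<phi> \<le> K * norm \<phi>"
  proof (rule seminorm_bounded_of_closed_sublevels)
    fix \<phi> \<psi> :: "'x \<Rightarrow>\<^sub>L real"
    have "N (\<phi> - \<psi>) \<le> (\<integral>\<omega>. \<bar>blinfun_apply \<phi> (f \<omega>)\<bar> + \<bar>blinfun_apply \<psi> (f \<omega>)\<bar> \<partial>completion \<mu>)"
      unfolding N_def by (intro integral_mono) (auto simp: int blinfun.diff_left)
    also have "\<dots> = N \<phi> + N \<psi>"
      unfolding N_def by (intro Bochner_Integration.integral_add) (auto simp: int)
    finally show "N (\<phi> - \<psi>) \<le> N \<phi> + N \<psi>" .
  next
    show "N (c *\<^sub>R \<phi>) \<le> \<bar>c\<bar> * N \<phi>" for c \<phi>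
      by (simp add: N_def blinfun.scaleR_left abs_mult)
  next
    fix n :: nat
    show "closed {\<phi>. N \<phi> \<le> real n}"
      unfolding closed_sequential_limits
    proof (intro allI impI, elim conjE, unfold mem_Collect_eq)
      fix s \<phi> assume s: "\<forall>k. N (s k) \<le> real n" and lim: "s \<longlonglongrightarrow> \<phi>"
      have nn: "(\<integral>\<^sup>+\<omega>. ennreal \<bar>blinfun_apply \<psi> (f \<omega>)\<bar> \<partial>completion \<mu>) = ennreal (N \<psi>)" for \<psi>
        unfolding N_def by (rule nn_integral_eq_integral) (auto simp: int)
      have "(\<lambda>k. ennreal \<bar>blinfun_apply (s k) (f \<omega>)\<bar>) \<longlonglongrightarrow> ennreal \<bar>blinfun_apply \<phi> (f \<omega>)\<bar>" for \<omega>
        by (intro tendsto_ennrealI tendsto_rabs blinfun.tendsto lim tendsto_const)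
      then have "ennreal (N \<phi>) =
          (\<integral>\<^sup>+\<omega>. liminf (\<lambda>k. ennreal \<bar>blinfun_apply (s k) (f \<omega>)\<bar>) \<partial>completion \<mu>)"
        unfolding nn[symmetric] by (intro nn_integral_cong) (metis lim_imp_Liminf sequentially_bot)
      also have "\<dots> \<le> liminf (\<lambda>k. \<integral>\<^sup>+\<omega>. ennreal \<bar>blinfun_apply (s k) (f \<omega>)\<bar> \<partial>completion \<mu>)"
        by (intro nn_integral_liminf measurable_compose[OF _ measurable_ennreal]
            borel_measurable_abs borel_measurable_integrable int)
      also have "\<dots> \<le> liminf (\<lambda>k. ennreal (real n))"
        unfolding nn using s by (intro Liminf_mono always_eventually allI ennreal_leI) auto
      finally have "ennreal (N \<phi>) \<le> ennreal (real n)" by (simp add: Liminf_const)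
      then show "N \<phi> \<le> real n" by simp
    qed
  qed
  then obtain K where K: "\<And>\<phi>. N \<phi> \<le> K * norm \<phi>" by blast
  have "N \<phi> \<le> \<bar>K\<bar>" if "norm \<phi> \<le> 1" for \<phi>
  proof -
    have "N \<phi> \<le> K * norm \<phi>" by (rule K)
    also have "\<dots> \<le> \<bar>K\<bar> * 1" using that by (intro mult_mono) auto
    finally show ?thesis by simp
  qed
  then show ?thesis
    unfolding N_def[symmetric] by (intro bdd_aboveI2[of _ _ "\<bar>K\<bar>"]) auto
qed

lemma pettis_norm_upper:
  assumes "f \<in> pettis_functions \<mu> UNIV" and "norm \<phi> \<le> 1"
  shows "(\<integral>\<omega>. \<bar>blinfun_apply \<phi> (f \<omega>)\<bar> \<partial>completion \<mu>) \<le> pettis_norm \<mu> f"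
  unfolding pettis_norm_def using assms by (intro cSUP_upper pettis_norm_bdd_above) auto

lemma pettis_norm_least:
  fixes f :: "'m \<Rightarrow> 'x::real_normed_vector"
  assumes "\<And>\<phi> :: 'x \<Rightarrow>\<^sub>L real. norm \<phi> \<le> 1 \<Longrightarrow> (\<integral>\<omega>. \<bar>blinfun_apply \<phi> (f \<omega>)\<bar> \<partial>completion \<mu>) \<le> C"
  shows "pettis_norm \<mu> f \<le> C"
  unfolding pettis_norm_def using assms by (intro cSUP_least) (auto intro: exI[of _ 0])

lemma pettis_seminormed_space:
  "carrier_seminormed_space (pettis_seminormed \<mu> :: ('m \<Rightarrow> 'x::real_normed_vector) nspace) (\<lambda>_. 0)"
proof -
  interpret carrier_vector_space "pettis_seminormed \<mu> :: ('m \<Rightarrow> 'x) nspace" "\<lambda>_. 0"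
    unfolding pettis_seminormed_def
    by (intro function_space_vector_space pettis_functions_subspace subspace_UNIV)
  show ?thesis
  proof
    fix f :: "'m \<Rightarrow> 'x" and c
    assume "f \<in> carr (pettis_seminormed \<mu>)"
    then have f: "f \<in> pettis_functions \<mu> UNIV"
      by (simp add: pettis_seminormed_def function_space_def)
    have "pettis_norm \<mu> (\<lambda>\<omega>. c *\<^sub>R f \<omega>) \<le> \<bar>c\<bar> * pettis_norm \<mu> f"
      by (rule pettis_norm_least)
        (simp add: blinfun.scaleR_right abs_mult mult_left_mono pettis_norm_upper[OF f])
    then show "nrm (pettis_seminormed \<mu>) (scale (pettis_seminormed \<mu>) c f) \<le>
        \<bar>c\<bar> * nrm (pettis_seminormed \<mu>) f"
      by (simp add: pettis_seminormed_def function_space_def)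
    fix g :: "'m \<Rightarrow> 'x"
    assume "g \<in> carr (pettis_seminormed \<mu>)"
    then have g: "g \<in> pettis_functions \<mu> UNIV"
      by (simp add: pettis_seminormed_def function_space_def)
    have "pettis_norm \<mu> (\<lambda>\<omega>. f \<omega> + g \<omega>) \<le> pettis_norm \<mu> f + pettis_norm \<mu> g"
    proof (rule pettis_norm_least)
      fix \<phi> :: "'x \<Rightarrow>\<^sub>L real" assume \<phi>: "norm \<phi> \<le> 1"
      note int = pettis_integrable[OF f] pettis_integrable[OF g]
      have "(\<integral>\<omega>. \<bar>blinfun_apply \<phi> (f \<omega> + g \<omega>)\<bar> \<partial>completion \<mu>) \<le>
          (\<integral>\<omega>. \<bar>blinfun_apply \<phi> (f \<omega>)\<bar> + \<bar>blinfun_apply \<phi> (g \<omega>)\<bar> \<partial>completion \<mu>)"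
        by (intro integral_mono) (auto simp: int blinfun.add_right)
      also have "\<dots> = (\<integral>\<omega>. \<bar>blinfun_apply \<phi> (f \<omega>)\<bar> \<partial>completion \<mu>) +
          (\<integral>\<omega>. \<bar>blinfun_apply \<phi> (g \<omega>)\<bar> \<partial>completion \<mu>)"
        by (intro Bochner_Integration.integral_add) (auto simp: int)
      also have "\<dots> \<le> pettis_norm \<mu> f + pettis_norm \<mu> g"
        by (intro add_mono pettis_norm_upper f g \<phi>)
      finally show "(\<integral>\<omega>. \<bar>blinfun_apply \<phi> (f \<omega> + g \<omega>)\<bar> \<partial>completion \<mu>) \<le>
          pettis_norm \<mu> f + pettis_norm \<mu> g" .
    qed
    then show "nrm (pettis_seminormed \<mu>) (add (pettis_seminormed \<mu>) f g) \<le>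
        nrm (pettis_seminormed \<mu>) f + nrm (pettis_seminormed \<mu>) g"
      by (simp add: pettis_seminormed_def function_space_def)
  qed
qed

context linear_metric_selection
begin

text \<open>
  The pointwise contraction acts on the Pettis norm through functionals: precomposition with it
  maps the unit ball of the dual space into itself, so the supremum is taken over fewer functionals.
\<close>

lemma norm_compose_p_le: "norm (\<phi> o\<^sub>L Blinfun p) \<le> norm \<phi>"
proof (rule norm_blinfun_bound)
  fix x
  have "norm (blinfun_apply \<phi> (p x)) \<le> norm \<phi> * norm (p x)" by (rule norm_blinfun)
  also have "\<dots> \<le> norm \<phi> * norm x" by (intro mult_left_mono norm_p_le) simp
  finally show "norm (blinfun_apply (\<phi> o\<^sub>L Blinfun p) x) \<le> norm \<phi> * norm x"
    by (simp add: bounded_linear_Blinfun_apply[OF bounded_linear_p])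
qed simp

lemma pettis_lifting:
  fixes \<mu> :: "'m measure"
  shows
  "contractive_lifting (pettis_seminormed \<mu>) (\<lambda>_. 0) (pettis_functions \<mu> J)
    (\<lambda>f \<omega>. if \<omega> \<in> space \<mu> then p (f \<omega>) else 0)"
  unfolding pettis_seminormed_def
proof (intro function_space_lifting pettis_functions_subspace subspace_UNIV subspace_J
    pettis_functions_mono)
  fix f :: "'m \<Rightarrow> 'x" assume f: "f \<in> pettis_functions \<mu> UNIV"
  have "(\<lambda>\<omega>. q (f \<omega>)) \<in> pettis_functions \<mu> J"
    by (intro pettis_functions_map[OF f bounded_linear_q] q_mem)
  then show "(\<lambda>\<omega>. if \<omega> \<in> space \<mu> then q (f \<omega>) else f \<omega>) \<in> pettis_functions \<mu> J"
    by (subst pettis_functions_cong) auto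
  show "pettis_norm \<mu> (\<lambda>\<omega>. if \<omega> \<in> space \<mu> then p (f \<omega>) else 0) \<le> pettis_norm \<mu> f"
  proof (rule pettis_norm_least)
    fix \<phi> :: "'x \<Rightarrow>\<^sub>L real" assume \<phi>: "norm \<phi> \<le> 1"
    have "(\<integral>\<omega>. \<bar>blinfun_apply \<phi> (if \<omega> \<in> space \<mu> then p (f \<omega>) else 0)\<bar> \<partial>completion \<mu>) =
        (\<integral>\<omega>. \<bar>blinfun_apply (\<phi> o\<^sub>L Blinfun p) (f \<omega>)\<bar> \<partial>completion \<mu>)"
      by (intro Bochner_Integration.integral_cong)
        (auto simp: bounded_linear_Blinfun_apply[OF bounded_linear_p])
    also have "\<dots> \<le> pettis_norm \<mu> f"
      by (intro pettis_norm_upper f order_trans[OF norm_compose_p_le \<phi>])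
    finally show "(\<integral>\<omega>. \<bar>blinfun_apply \<phi> (if \<omega> \<in> space \<mu> then p (f \<omega>) else 0)\<bar> \<partial>completion \<mu>)
        \<le> pettis_norm \<mu> f" .
  qed
qed (auto simp: pettis_functions_def strongly_measurable_def)

lemma P1_QLP: "QLP TYPE('v::banach) (P1_space \<mu>) (P1_subspace \<mu> J)"
proof -
  let ?P = "\<lambda>f \<omega>. if \<omega> \<in> space \<mu> then p (f \<omega>) else 0"
  interpret seminormed_contractive_lifting "pettis_seminormed \<mu>" "\<lambda>_. 0" "pettis_functions \<mu> J" ?P
    by (intro seminormed_contractive_lifting.intro pettis_seminormed_space pettis_lifting)
  show ?thesis
    unfolding P1_space_def P1_subspace_def completed_space_def completed_subspace_def
    by (rule contractive_lifting.QLP[OF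
          seminormed_contractive_lifting.quotient_lifting[OF cauchy_lifting]])
qed

end


section \<open>The quotient lifting property\<close>

theorem mainTheorem12:
  fixes J :: "'x::banach set"
    and \<mu> :: "'m measure"
  assumes "subspace J"
    and "proximinal J"
    and "\<exists>q. linear_selection J q"
  shows
    "(\<forall>r\<ge>1. QLP TYPE('v::banach) (ell_space r UNIV) (carr (ell_space r J))) \<and>
     QLP TYPE('v) (ell_infinity_space UNIV) (carr (ell_infinity_space J)) \<and>
     QLP TYPE('v) (c0_space UNIV) (carr (c0_space J)) \<and>
     QLP TYPE('v) (c_space UNIV) (carr (c_space J)) \<and>
     (compact (UNIV :: 'o::t2_space set) \<longrightarrow>
       QLP TYPE('v) (type_space :: ('o \<Rightarrow>\<^sub>C 'x) nspace)
         {f. range (apply_bcontfun f) \<subseteq> J}) \<and>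
     (compact (UNIV :: 'k::metric_space set) \<longrightarrow>
       QLP TYPE('v) (lip_max_space UNIV :: ('k \<Rightarrow> 'x) nspace) (carr (lip_max_space J)) \<and>
       QLP TYPE('v) (lip_sum_space UNIV :: ('k \<Rightarrow> 'x) nspace) (carr (lip_sum_space J))) \<and>
     QLP TYPE('v) (L1_space \<mu>) (L1_subspace \<mu> J) \<and>
     QLP TYPE('v) (P1_space \<mu>) (P1_subspace \<mu> J) \<and>
     QLP TYPE('v) (type_space :: ('y::banach \<Rightarrow>\<^sub>L 'x) nspace)
       {A. range (blinfun_apply A) \<subseteq> J}"
proof -
  obtain q where "linear_selection J q" using assms(3) ..
  then interpret linear_metric_selection J q
    using assms(1) by unfold_locales
  show ?thesis
    by (intro conjI allI impI ell_QLP ell_infinity_QLP c0_QLP c_QLP continuous_QLP lip_max_QLP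
        lip_sum_QLP L1_QLP P1_QLP operator_QLP)
qed

end
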